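(* Let $H=\{(z_1,z_2)\in(\mathbb{C}^* )^2 \mid 1+z_1+z_2=0\}$, let $H_{trop}\subset(\mathbb{C}^* )^2$ be its associated phase tropical line, and let $i_H:H\hookrightarrow(\mathbb{C}^* )^2$ be the canonical embedding. There exists a continuous map $\Psi:H\times[0,1]\to(\mathbb{C}^* )^2$ such that the maps $\Psi_t:H\to(\mathbb{C}^* )^2$, $P\mapsto\Psi(P,t)$, for $t\in[0,1]$, satisfy: 1. $\Psi_0=i_H$; 2. $\Psi_1(H)=H_{trop}$; 3. $\Psi_t$ is a homeomorphism onto its image for each $t\in[0,1]$.
   Context: Let $K$ be the field of (real-power) Puiseux series $\sum_{j\in I}c_jt^j$ with $c_j\in\mathbb{C}$ and $I\subset\mathbb{R}$ well ordered. Every $z\in K^*=K\setminus\{0\}$ can be written $z=r_0e^{i\varphi_0}t^{j_0}+\text{(terms with higher exponent)}$ with $r_0>0$. Define $\mathrm{val}_{\mathbb{C}}:K^*\to\mathbb{C}^*$ by $\mathrm{val}_{\mathbb{C}}(z)=e^{-j_0+i\varphi_0}$, and let $\mathrm{val}^2_{\mathbb{C}}:(K^* )^2\to(\mathbb{C}^* )^2$ be its componentwise extension. Let $f=1+z_1+z_2\in K[z_1,z_2]$ with zero set $Z(f)\subset(K^* )^2$. The phase tropical line associated to $H$ is $H_{trop}:=\overline{\mathrm{val}^2_{\mathbb{C}}(Z(f))}$, the closure being taken in $(\mathbb{C}^* )^2$. *)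

theory Defs
  imports "HOL-Analysis.Analysis"
begin

definition well_ordered :: "real set \<Rightarrow> bool" where
  "well_ordered I \<longleftrightarrow> (\<forall>A\<subseteq>I. A \<noteq> {} \<longrightarrow> (\<exists>m\<in>A. \<forall>x\<in>A. m \<le> x))"

lemma well_ordered_empty [simp]: "well_ordered {}"
  by (auto simp: well_ordered_def)

lemma well_ordered_singleton [simp]: "well_ordered {a}"
  by (auto simp: well_ordered_def subset_singleton_iff)

lemma well_ordered_subset: "well_ordered I \<Longrightarrow> J \<subseteq> I \<Longrightarrow> well_ordered J"
  unfolding well_ordered_def by blast

lemma well_ordered_Un:
  assumes "well_ordered I" "well_ordered J"
  shows "well_ordered (I \<union> J)"
  unfolding well_ordered_def
proof (intro allI impI)
  fix A assume A: "A \<subseteq> I \<union> J" "A \<noteq> {}"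
  show "\<exists>m\<in>A. \<forall>x\<in>A. m \<le> x"
  proof (cases "A \<inter> I = {} \<or> A \<inter> J = {}")
    case True
    with A have "A \<subseteq> I \<or> A \<subseteq> J" by blast
    with A(2) assms show ?thesis unfolding well_ordered_def by blast
  next
    case False
    obtain m where m: "m \<in> A \<inter> I" "\<forall>x\<in>A \<inter> I. m \<le> x"
      using assms(1) False unfolding well_ordered_def by (metis inf_le2)
    obtain n where n: "n \<in> A \<inter> J" "\<forall>x\<in>A \<inter> J. n \<le> x"
      using assms(2) False unfolding well_ordered_def by (metis inf_le2)
    have "min m n \<in> A" using m n by (auto simp: min_def)
    moreover have "\<forall>x\<in>A. min m n \<le> x" using m(2) n(2) A(1) by (auto simp: min_le_iff_disj)
    ultimately show ?thesis by blast
  qed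
qed

text \<open>
  The series \<open>\<Sum>j\<in>I. c\<^sub>j t\<^sup>j\<close> with well-ordered \<open>I\<close> is identified with its coefficient
  function \<open>j \<mapsto> c\<^sub>j\<close>, extended by zero. Only the additive structure and the constant series
  \<open>1 = t\<^sup>0\<close> are set up: they suffice to evaluate the polynomial \<open>1 + z\<^sub>1 + z\<^sub>2\<close>.
\<close>

typedef puiseux = "{c :: real \<Rightarrow> complex. well_ordered {j. c j \<noteq> 0}}"
  morphisms coeff Puiseux
  by (rule exI[of _ "\<lambda>_. 0"]) simp

setup_lifting type_definition_puiseux

instantiation puiseux :: "{ab_group_add, one}"
begin

lift_definition zero_puiseux :: puiseux is "\<lambda>_. 0"
  by simp

lift_definition one_puiseux :: puiseux is "\<lambda>j. if j = 0 then 1 else 0"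
  by simp

lift_definition plus_puiseux :: "puiseux \<Rightarrow> puiseux \<Rightarrow> puiseux" is "\<lambda>a b j. a j + b j"
  by (rule well_ordered_subset, erule (1) well_ordered_Un) auto

lift_definition uminus_puiseux :: "puiseux \<Rightarrow> puiseux" is "\<lambda>a j. - a j"
  by simp

lift_definition minus_puiseux :: "puiseux \<Rightarrow> puiseux \<Rightarrow> puiseux" is "\<lambda>a b j. a j - b j"
  by (rule well_ordered_subset, erule (1) well_ordered_Un) auto

instance
  by standard (transfer; simp add: fun_eq_iff algebra_simps)+

end

text \<open>The exponent \<open>j\<^sub>0\<close> of the lowest-order term; meaningful for nonzero series.\<close>

definition lowest_exponent :: "puiseux \<Rightarrow> real" where
  "lowest_exponent z = (LEAST j. coeff z j \<noteq> 0)"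

lemma coeff_lowest_exponent:
  assumes "z \<noteq> 0"
  shows "coeff z (lowest_exponent z) \<noteq> 0"
    and "coeff z j \<noteq> 0 \<Longrightarrow> lowest_exponent z \<le> j"
proof -
  have "{j. coeff z j \<noteq> 0} \<noteq> {}"
    using assms by transfer auto
  moreover have "well_ordered {j. coeff z j \<noteq> 0}"
    using coeff by auto
  ultimately obtain m where m: "coeff z m \<noteq> 0" "\<And>x. coeff z x \<noteq> 0 \<Longrightarrow> m \<le> x"
    unfolding well_ordered_def by blast
  then have "lowest_exponent z = m"
    unfolding lowest_exponent_def by (intro Least_equality) auto
  with m show "coeff z (lowest_exponent z) \<noteq> 0"
    and "coeff z j \<noteq> 0 \<Longrightarrow> lowest_exponent z \<le> j" by auto
qed

definition val_C :: "puiseux \<Rightarrow> complex" where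
  "val_C z = exp (- complex_of_real (lowest_exponent z)
                  + \<i> * complex_of_real (Arg (coeff z (lowest_exponent z))))"

definition val2_C :: "puiseux \<times> puiseux \<Rightarrow> complex \<times> complex" where
  "val2_C = map_prod val_C val_C"

definition torus2 :: "(complex \<times> complex) set" where
  "torus2 = (UNIV - {0}) \<times> (UNIV - {0})"

definition Z_f :: "(puiseux \<times> puiseux) set" where
  "Z_f = {(z1, z2). z1 \<noteq> 0 \<and> z2 \<noteq> 0 \<and> 1 + z1 + z2 = 0}"

definition H :: "(complex \<times> complex) set" where
  "H = {(z1, z2) \<in> torus2. 1 + z1 + z2 = 0}"

definition H_trop :: "(complex \<times> complex) set" where
  "H_trop = top_of_set torus2 closure_of (val2_C ` Z_f)"

end

theory Submission
  imports Defs
begin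

text \<open>
  Put \<open>z\<^sub>0 = 1\<close>. A point of \<open>H\<close> is a triangle with side vectors \<open>z\<^sub>0 + z\<^sub>1 + z\<^sub>2 = 0\<close>. Its squared side
  lengths, normalised to have sum 1, fill the disc inscribed in the standard simplex, without the
  three points of tangency; interior points of the disc come from two conjugate points of \<open>H\<close>, points
  of the bounding circle from one real point. The triangle where all three coordinates are at least
  1/6 is inscribed in this disc and cuts off three circular segments.

  \<open>\<Psi>\<^sub>1\<close> sends the inscribed triangle affinely to the triangle of angles, that is, to half of the closed
  coamoeba, and each segment to half of a leg: the chord on which the \<open>k\<close>-th coordinate is \<open>x\<close> is
  rescaled to the full edge and placed at modulus \<open>sqrt (5 x / (1 - x))\<close>.

  \<open>\<Psi>\<^sub>t\<close> interpolates linearly between the logarithms of the moduli, and between the phases followed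
  by normalisation. For \<open>t < 1\<close> the moduli determine the triangle, since the modulus on the \<open>k\<close>-th leg
  increases with the \<open>k\<close>-th coordinate, and the sign of the imaginary part of the first coordinate
  separates conjugate points. Logarithms of moduli move by a bounded amount only, so every \<open>\<Psi>\<^sub>t\<close> is
  proper, and a proper injective continuous map is an embedding.
\<close>

section \<open>The disc of normalised squared side lengths\<close>

text \<open>For a triangle with squared side lengths \<open>a\<close>, \<open>b\<close>,
  \<open>c\<close> of sum 1, Heron's formula reads 16 A^2 = 1 - 2 (a^2 + b^2 + c^2). The last
  inequality thus says that such a triangle exists, with equality for the degenerate ones.\<close>

definition disc_coords :: "real \<Rightarrow> real \<Rightarrow> real \<Rightarrow> bool" where
  "disc_coords a b c \<longleftrightarrow> a > 0 \<and> b > 0 \<and> c > 0 \<and> a + b + c = 1 \<and> a\<^sup>2 + b\<^sup>2 + c\<^sup>2 \<le> 1/2"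

text \<open>On the chord of the disc where one coordinate is \<open>x\<close>, the difference of the
  other two runs through the interval of this radius around 0; see
  \<open>chord_identity\<close>.\<close>

definition half_chord :: "real \<Rightarrow> real" where
  "half_chord x = sqrt (x * (2 - 3 * x))"

text \<open>Rescaling a chord to a full edge multiplies the difference of the two large coordinates
  by \<open>1 / (2 * half_chord x)\<close>. This is the excess of that factor over its value 1 on
  the cutting chord \<open>x = 1/6\<close>, truncated so as to vanish on the inscribed
  triangle.\<close>

definition stretch :: "real \<Rightarrow> real" where
  "stretch x = 1 / (2 * half_chord (min x (1/6))) - 1"

text \<open>A single formula, visibly continuous, for the function that the lemmas
  \<open>bary_central\<close> and \<open>bary_leg\<close> describe piecewise.\<close>

definition bary :: "real \<Rightarrow> real \<Rightarrow> real \<Rightarrow> real" where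
  "bary a b c = 2 * max a (1/6) - 1/3 - max 0 (1/6 - b) - max 0 (1/6 - c)
     + (a - b) * stretch c + (a - c) * stretch b"

text \<open>The quotient \<open>x / (1 - x)\<close> compares one squared side with the sum of the
  other two. The factor 5 makes the modulus reach 1 exactly at \<open>x = 1/6\<close>, where segment
  and inscribed triangle meet.\<close>

definition leg_modulus :: "real \<Rightarrow> real" where
  "leg_modulus x = min 1 (sqrt (5 * x / (1 - x)))"

lemma disc_coords_swap:
  "disc_coords a b c \<Longrightarrow> disc_coords b a c" "disc_coords a b c \<Longrightarrow> disc_coords a c b"
  "disc_coords a b c \<Longrightarrow> disc_coords c a b" "disc_coords a b c \<Longrightarrow> disc_coords c b a"
  by (auto simp: disc_coords_def algebra_simps)

lemma bary_swap: "bary a b c = bary a c b"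
  by (simp add: bary_def algebra_simps)

text \<open>The \<open>stretch\<close> terms cancel in pairs, and the truncated terms of each single
  coordinate combine to a linear function.\<close>

lemma bary_sum:
  assumes "a + b + c = 1"
  shows "bary a b c + bary b a c + bary c a b = 1"
proof -
  have m: "2 * max x (1/6) - 1/3 - 2 * max 0 (1/6 - x) = 2 * x - 1/3" for x :: real
    by (auto simp: max_def)
  have "bary a b c + bary b a c + bary c a b
     = (2 * max a (1/6) - 1/3 - 2 * max 0 (1/6 - a)) + (2 * max b (1/6) - 1/3 - 2 * max 0 (1/6 - b))
      + (2 * max c (1/6) - 1/3 - 2 * max 0 (1/6 - c))"
    unfolding bary_def by (simp add: algebra_simps)
  also have "\<dots> = 1"
    unfolding m using assms by simp
  finally show ?thesis .
qed

section \<open>Chords of the disc and the piecewise form of \<open>bary\<close>\<close>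

lemma half_chord_pos: "0 < x \<Longrightarrow> x < 2/3 \<Longrightarrow> half_chord x > 0"
  by (simp add: half_chord_def)

lemma half_chord_sq: "0 \<le> x \<Longrightarrow> x \<le> 2/3 \<Longrightarrow> (half_chord x)\<^sup>2 = x * (2 - 3 * x)"
  by (simp add: half_chord_def)

lemma half_chord_sixth: "half_chord (1/6) = 1/2"
  unfolding half_chord_def by (rule real_sqrt_unique) (auto simp: power2_eq_square)

lemma stretch_ge: "x \<ge> 1/6 \<Longrightarrow> stretch x = 0"
  by (simp add: stretch_def half_chord_sixth min_absorb2)

lemma stretch_le: "x \<le> 1/6 \<Longrightarrow> stretch x = 1 / (2 * half_chord x) - 1"
  by (simp add: stretch_def min_absorb1)

lemma disc_coords_le_two_thirds:
  assumes "disc_coords a b c" shows "a \<le> 2/3"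
proof -
  have b: "b = 1 - a - c" using assms by (auto simp: disc_coords_def)
  have "a\<^sup>2 + (1 - a - c)\<^sup>2 + c\<^sup>2 \<le> 1/2" using assms b by (auto simp: disc_coords_def)
  \<comment> \<open>This is the square of \<open>c - b\<close>: on the disc, \<open>a\<close> is
    largest where the other two coordinates agree.\<close>
  moreover have "(2 * c - (1 - a))\<^sup>2 \<ge> 0" by simp
  ultimately have "a * (3 * a - 2) \<le> 0"
    by (auto simp: power2_eq_square algebra_simps)
  moreover have "a > 0" using assms by (auto simp: disc_coords_def)
  ultimately show ?thesis by (simp add: mult_le_0_iff)
qed

text \<open>A second coordinate below 1/6 would leave more than 2/3 for the third, beyond the
  maximum on the disc.\<close>

lemma disc_coords_legs_disjoint:
  assumes "disc_coords a b c" "c \<le> 1/6" shows "a \<ge> 1/6" "b \<ge> 1/6"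
  using disc_coords_le_two_thirds[OF assms(1)] assms(2)
    disc_coords_le_two_thirds[OF disc_coords_swap(1)[OF assms(1)]] assms(1)
  by (auto simp: disc_coords_def)

lemma bary_central:
  assumes "a \<ge> 1/6" "b \<ge> 1/6" "c \<ge> 1/6" shows "bary a b c = 2 * a - 1/3"
  using assms by (simp add: bary_def stretch_ge)

lemma bary_leg:
  assumes "disc_coords a b c" "c \<le> 1/6"
  shows "bary a b c = 1/2 + (a - b) / (2 * half_chord c)"
    and "bary b a c = 1/2 - (a - b) / (2 * half_chord c)"
    and "bary c a b = 0"
proof -
  note d = disc_coords_legs_disjoint[OF assms]
  have s: "a + b + c = 1" using assms by (simp add: disc_coords_def)
  show "bary a b c = 1/2 + (a - b) / (2 * half_chord c)"
    using d assms(2) s by (simp add: bary_def stretch_ge stretch_le max_def algebra_simps diff_divide_distrib)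
  show "bary b a c = 1/2 - (a - b) / (2 * half_chord c)"
    using d assms(2) s by (simp add: bary_def stretch_ge stretch_le max_def algebra_simps diff_divide_distrib)
  show "bary c a b = 0"
    using d assms(2) by (simp add: bary_def stretch_ge max_def)
qed

lemma disc_coords_cases:
  assumes "disc_coords a b c"
  obtains (central) "a \<ge> 1/6" "b \<ge> 1/6" "c \<ge> 1/6"
    | (leg_a) "a \<le> 1/6" | (leg_b) "b \<le> 1/6" | (leg_c) "c \<le> 1/6"
  by linarith

lemma chord_identity:
  fixes a b c :: real
  assumes "a + b + c = 1"
  shows "c * (2 - 3 * c) - (a - b)\<^sup>2 = 2 * (1/2 - (a\<^sup>2 + b\<^sup>2 + c\<^sup>2))"
proof -
  have c: "c = 1 - a - b" using assms by simp
  show ?thesis unfolding c by (simp add: power2_eq_square algebra_simps)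
qed

lemma disc_coords_chord:
  assumes "disc_coords a b c"
  shows "\<bar>a - b\<bar> \<le> half_chord c"
    and "\<bar>a - b\<bar> = half_chord c \<longleftrightarrow> a\<^sup>2 + b\<^sup>2 + c\<^sup>2 = 1/2"
proof -
  have i: "c * (2 - 3 * c) - (a - b)\<^sup>2 = 2 * (1/2 - (a\<^sup>2 + b\<^sup>2 + c\<^sup>2))"
    using assms chord_identity by (simp add: disc_coords_def)
  then have le: "(a - b)\<^sup>2 \<le> c * (2 - 3 * c)"
    using assms by (auto simp: disc_coords_def)
  show "\<bar>a - b\<bar> \<le> half_chord c"
    unfolding half_chord_def using real_le_rsqrt[of "\<bar>a - b\<bar>"] le by simp
  have "\<bar>a - b\<bar> = half_chord c \<longleftrightarrow> (a - b)\<^sup>2 = c * (2 - 3 * c)"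
    unfolding half_chord_def by (metis real_sqrt_abs real_sqrt_eq_iff)
  then show "\<bar>a - b\<bar> = half_chord c \<longleftrightarrow> a\<^sup>2 + b\<^sup>2 + c\<^sup>2 = 1/2"
    using i by auto
qed

lemma half_chord_pos_disc:
  assumes "disc_coords a b c" "c \<le> 1/6"
  shows "half_chord c > 0"
  using assms by (intro half_chord_pos) (auto simp: disc_coords_def)

lemma bary_leg_nonneg:
  assumes "disc_coords a b c" "c \<le> 1/6"
  shows "bary a b c \<ge> 0" "bary b a c \<ge> 0"
proof -
  have "half_chord c > 0" by (rule half_chord_pos_disc[OF assms])
  then have "\<bar>(a - b) / (2 * half_chord c)\<bar> \<le> 1/2"
    using disc_coords_chord(1)[OF assms(1)] by (simp add: abs_divide field_simps)
  then show "bary a b c \<ge> 0" "bary b a c \<ge> 0"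
    unfolding bary_leg[OF assms] abs_le_iff by linarith+
qed

lemma bary_nonneg:
  assumes "disc_coords a b c" shows "bary a b c \<ge> 0"
  using assms
proof (cases rule: disc_coords_cases)
  case central
  then show ?thesis by (simp add: bary_central)
next
  case leg_a
  with bary_leg(3)[OF disc_coords_swap(4)[OF assms]] bary_swap[of a b c] show ?thesis by simp
next
  case leg_b
  with bary_leg_nonneg(1)[OF disc_coords_swap(2)[OF assms]] bary_swap[of a b c] show ?thesis by simp
next
  case leg_c
  with bary_leg_nonneg(1)[OF assms] show ?thesis by simp
qed

lemma bary_leg_vertex_iff:
  assumes "disc_coords a b c" "c \<le> 1/6"
  shows "bary a b c = 1 \<or> bary b a c = 1 \<longleftrightarrow> a\<^sup>2 + b\<^sup>2 + c\<^sup>2 = 1/2"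
proof -
  have "half_chord c > 0" by (rule half_chord_pos_disc[OF assms])
  then have "bary a b c = 1 \<or> bary b a c = 1 \<longleftrightarrow> \<bar>a - b\<bar> = half_chord c"
    unfolding bary_leg[OF assms] by (auto simp: field_simps abs_if)
  then show ?thesis using disc_coords_chord(2)[OF assms(1)] by simp
qed

text \<open>The bounding circle, that is, the degenerate triangles, is collapsed to the three
  vertices, since the ends of every chord go to the ends of an edge. This is what makes the limiting
  phases of real points real.\<close>

lemma bary_vertex_iff:
  assumes "disc_coords a b c"
  shows "bary a b c = 1 \<or> bary b a c = 1 \<or> bary c a b = 1 \<longleftrightarrow> a\<^sup>2 + b\<^sup>2 + c\<^sup>2 = 1/2"
  using assms
proof (cases rule: disc_coords_cases)
  case central
  show ?thesis
  proof
    assume "bary a b c = 1 \<or> bary b a c = 1 \<or> bary c a b = 1"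
    then have "a = 2/3 \<or> b = 2/3 \<or> c = 2/3" using central by (auto simp: bary_central)
    then have "a = 2/3 \<and> b = 1/6 \<and> c = 1/6 \<or> a = 1/6 \<and> b = 2/3 \<and> c = 1/6 \<or> a = 1/6 \<and> b = 1/6 \<and> c = 2/3"
      using central assms by (auto simp: disc_coords_def)
    then show "a\<^sup>2 + b\<^sup>2 + c\<^sup>2 = 1/2"
      by (elim disjE conjE; simp only:; simp add: power2_eq_square)
  next
    assume e: "a\<^sup>2 + b\<^sup>2 + c\<^sup>2 = 1/2"
    \<comment> \<open>The inscribed triangle touches the boundary circle only in its vertices.\<close>
    have "(a - 1/6) * (b - 1/6) + (b - 1/6) * (c - 1/6) + (c - 1/6) * (a - 1/6) = 0"
    proof -
      have c: "c = 1 - a - b" using assms by (simp add: disc_coords_def)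
      show ?thesis using e unfolding c by (simp add: power2_eq_square field_simps)
    qed
    moreover have "(a - 1/6) * (b - 1/6) \<ge> 0" "(b - 1/6) * (c - 1/6) \<ge> 0" "(c - 1/6) * (a - 1/6) \<ge> 0"
      using central by auto
    ultimately have "(a - 1/6) * (b - 1/6) = 0" "(b - 1/6) * (c - 1/6) = 0" "(c - 1/6) * (a - 1/6) = 0"
      by linarith+
    then have "a = 2/3 \<or> b = 2/3 \<or> c = 2/3"
      using assms by (auto simp: disc_coords_def)
    then show "bary a b c = 1 \<or> bary b a c = 1 \<or> bary c a b = 1"
      using central by (auto simp: bary_central)
  qed
next
  case leg_a
  note d = disc_coords_swap(3)[OF disc_coords_swap(3)[OF assms]]
  show ?thesis using bary_leg_vertex_iff[OF d leg_a] bary_leg(3)[OF d leg_a]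
    by (auto simp: bary_swap[of a b c] bary_swap[of b c a] bary_swap[of c b a] algebra_simps)
next
  case leg_b
  note d = disc_coords_swap(2)[OF assms]
  show ?thesis using bary_leg_vertex_iff[OF d leg_b] bary_leg(3)[OF d leg_b]
    by (auto simp: bary_swap[of a c b] bary_swap[of b c a] bary_swap[of c b a] algebra_simps)
next
  case leg_c
  show ?thesis using bary_leg_vertex_iff[OF assms leg_c] bary_leg(3)[OF assms leg_c] by auto
qed

text \<open>Identifies the vertex to which a degenerate triangle goes as that of its longest side.
  In a segment the largest coordinate exceeds the middle one by the half chord, which is at least
  the small coordinate; so it is at least the sum of the other two.\<close>

lemma bary_eq_one_imp_ge_half:
  assumes "disc_coords a b c" "bary a b c = 1" shows "a \<ge> 1/2"
  using assms(1)
proof (cases rule: disc_coords_cases)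
  case central
  then show ?thesis using assms by (auto simp: bary_central)
next
  case leg_a
  with bary_leg(3)[OF disc_coords_swap(4)[OF assms(1)]] bary_swap[of a b c] assms(2) show ?thesis by simp
next
  case leg_b
  note d = disc_coords_swap(2)[OF assms(1)]
  have "half_chord b > 0" by (rule half_chord_pos_disc[OF d leg_b])
  then have 1: "a - c = half_chord b"
    using assms(2) bary_leg(1)[OF d leg_b] bary_swap[of a b c] by (auto simp: field_simps)
  \<comment> \<open>Squared, this is \<open>b \<le> 2 - 3 * b\<close>, that is,
    \<open>b \<le> 1/2\<close>.\<close>
  have 2: "half_chord b \<ge> b"
    unfolding half_chord_def using leg_b assms(1)
    by (intro real_le_rsqrt) (auto simp: power2_eq_square disc_coords_def)
  show ?thesis using 1 2 assms(1) by (auto simp: disc_coords_def)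
next
  case leg_c
  have "half_chord c > 0" by (rule half_chord_pos_disc[OF assms(1) leg_c])
  then have 1: "a - b = half_chord c"
    using assms(2) bary_leg(1)[OF assms(1) leg_c] by (auto simp: field_simps)
  have 2: "half_chord c \<ge> c"
    unfolding half_chord_def using leg_c assms(1)
    by (intro real_le_rsqrt) (auto simp: power2_eq_square disc_coords_def)
  show ?thesis using 1 2 assms(1) by (auto simp: disc_coords_def)
qed

section \<open>Moduli on the legs; recovering the disc coordinates\<close>

lemma leg_modulus_pos: "0 < x \<Longrightarrow> x < 1 \<Longrightarrow> leg_modulus x > 0"
  by (simp add: leg_modulus_def)

lemma leg_modulus_le_one: "leg_modulus x \<le> 1"
  by (simp add: leg_modulus_def)

lemma leg_modulus_less_one_iff:
  assumes "0 < x" "x < 1" shows "leg_modulus x < 1 \<longleftrightarrow> x < 1/6"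
proof -
  have "5 * x / (1 - x) < 1 \<longleftrightarrow> x < 1/6" using assms by (simp add: field_simps)
  then show ?thesis by (simp add: leg_modulus_def min_less_iff_disj)
qed

lemma leg_modulus_eq_one: "1/6 \<le> x \<Longrightarrow> x < 1 \<Longrightarrow> leg_modulus x = 1"
  using leg_modulus_less_one_iff[of x] leg_modulus_le_one[of x] by (auto simp: not_less)

lemma leg_modulus_sq:
  assumes "0 < x" "x < 1" shows "(leg_modulus x)\<^sup>2 = min 1 (5 * x / (1 - x))"
  using assms by (auto simp: leg_modulus_def min_def)

lemma leg_modulus_mono:
  assumes "0 < x" "x \<le> y" "y < 1" shows "leg_modulus x \<le> leg_modulus y"
proof -
  have "5 * x / (1 - x) \<le> 5 * y / (1 - y)" using assms by (intro frac_le) auto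
  then show ?thesis unfolding leg_modulus_def by (intro min.mono) auto
qed

lemma leg_modulus_inj:
  assumes "0 < x" "x < 1" "0 < y" "y < 1" "leg_modulus x = leg_modulus y" "x < 1/6"
  shows "x = y"
proof -
  have "y < 1/6" using assms leg_modulus_less_one_iff by metis
  then have "leg_modulus x = sqrt (5 * x / (1 - x))" "leg_modulus y = sqrt (5 * y / (1 - y))"
    using assms leg_modulus_less_one_iff[of x] leg_modulus_less_one_iff[of y]
    unfolding leg_modulus_def by linarith+
  then have "5 * x / (1 - x) = 5 * y / (1 - y)" using assms(5) by simp
  then show ?thesis using assms by (simp add: field_simps)
qed

lemma disc_coords_bounds:
  assumes "disc_coords a b c" shows "0 < a" "a < 1" "0 < b" "b < 1" "0 < c" "c < 1"
  using assms by (auto simp: disc_coords_def)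

text \<open>The modulus, injective below 1/6, picks the chord, and \<open>bary\<close> the position
  on it.\<close>

lemma leg_determined:
  assumes "disc_coords a b c" "disc_coords a' b' c'" "leg_modulus c = leg_modulus c'" "c < 1/6"
    "bary a b c = bary a' b' c'"
  shows "a = a'" "b = b'" "c = c'"
proof -
  show c: "c = c'"
    by (rule leg_modulus_inj[OF disc_coords_bounds(5,6)[OF assms(1)]
          disc_coords_bounds(5,6)[OF assms(2)] assms(3,4)])
  have "half_chord c > 0" using assms(1,4) by (intro half_chord_pos_disc) auto
  then have "a - b = a' - b'"
    using assms(5) bary_leg(1)[OF assms(1)] bary_leg(1)[OF assms(2)] assms(4)
    unfolding c by simp
  with c show "a = a'" "b = b'" using assms(1,2) by (auto simp: disc_coords_def)
qed

text \<open>A modulus below 1 tells in which segment the point lies; if there is none, the point is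
  in the inscribed triangle, where \<open>bary\<close> is affine and injective.\<close>

lemma disc_coords_determined:
  assumes "disc_coords a b c" "disc_coords a' b' c'"
    and "leg_modulus a = leg_modulus a'" "leg_modulus b = leg_modulus b'" "leg_modulus c = leg_modulus c'"
    and "bary a b c = bary a' b' c'" "bary b a c = bary b' a' c'" "bary c a b = bary c' a' b'"
  shows "a = a' \<and> b = b' \<and> c = c'"
proof -
  note B = disc_coords_bounds[OF assms(1)] disc_coords_bounds[OF assms(2)]
  consider "a < 1/6" | "b < 1/6" | "c < 1/6" | "a \<ge> 1/6" "b \<ge> 1/6" "c \<ge> 1/6" by linarith
  then show ?thesis
  proof cases
    case 1
    show ?thesis
      using leg_determined[of b c a b' c' a'] assms 1 disc_coords_swap bary_swap by metis
  next
    case 2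
    show ?thesis
      using leg_determined[of a c b a' c' b'] assms 2 disc_coords_swap bary_swap by metis
  next
    case 3
    show ?thesis using leg_determined[of a b c a' b' c'] assms 3 by metis
  next
    case 4
    then have "a' \<ge> 1/6" "b' \<ge> 1/6" "c' \<ge> 1/6"
      using B assms leg_modulus_less_one_iff by (metis not_le)+
    then show ?thesis using 4 assms by (simp add: bary_central)
  qed
qed

text \<open>Inverts the passage from the disc to moduli and angles, for the inscribed triangle
  (\<open>\<mu> = 1\<close>) and for the segment of the third coordinate (\<open>\<mu> < 1\<close>).
  The other segments follow by permuting coordinates.\<close>

lemma disc_coords_realize:
  assumes "p \<ge> 0" "q \<ge> 0" "r \<ge> 0" "p + q + r = 1" "0 < \<mu>" "\<mu> \<le> 1" "\<mu> < 1 \<Longrightarrow> r = 0"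
  shows "\<exists>a b c. disc_coords a b c \<and> leg_modulus a = 1 \<and> leg_modulus b = 1 \<and> leg_modulus c = \<mu> \<and>
    bary a b c = p \<and> bary b a c = q \<and> bary c a b = r"
proof -
  show ?thesis
  proof (cases "\<mu> = 1")
    case True
    \<comment> \<open>Solves \<open>2 * a - 1/3 = p\<close> and its analogues, see
      \<open>bary_central\<close>.\<close>
    define a b c where "a = (p + 1/3) / 2" "b = (q + 1/3) / 2" "c = (r + 1/3) / 2"
    have ge: "a \<ge> 1/6" "b \<ge> 1/6" "c \<ge> 1/6" using assms by (auto simp: a_b_c_def)
    have s: "a + b + c = 1" using assms by (auto simp: a_b_c_def field_simps)
    have sq: "x\<^sup>2 \<le> x" if "x \<ge> 0" "x \<le> 1" for x :: real
      using that by (simp add: power2_eq_square mult_left_le)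
    have "p\<^sup>2 + q\<^sup>2 + r\<^sup>2 \<le> 1" using sq[of p] sq[of q] sq[of r] assms by simp
    moreover have "a\<^sup>2 + b\<^sup>2 + c\<^sup>2 = (p\<^sup>2 + q\<^sup>2 + r\<^sup>2 + 2/3 * (p + q + r) + 1/3) / 4"
      unfolding a_b_c_def by (simp add: power2_eq_square field_simps)
    ultimately have D: "disc_coords a b c"
      using ge s assms by (auto simp: disc_coords_def)
    have "bary a b c = p" "bary b a c = q" "bary c a b = r"
      using ge by (simp_all add: bary_central) (simp_all add: a_b_c_def field_simps)
    moreover have "leg_modulus a = 1" "leg_modulus b = 1" "leg_modulus c = 1"
      using ge disc_coords_bounds[OF D] leg_modulus_eq_one by blast+
    ultimately show ?thesis
      using D True by blast
  next
    case False
    then have \<mu>: "\<mu> < 1" and r: "r = 0" using assms by auto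
    have \<mu>2: "0 < \<mu>\<^sup>2" "\<mu>\<^sup>2 < 1" using \<mu> assms by (auto simp: power_less_one_iff abs_square_less_1)
    \<comment> \<open>\<open>c\<close> solves \<open>5 * c / (1 - c) = \<mu>\<^sup>2\<close>, and
      \<open>d\<close> is the value of \<open>a - b\<close> that \<open>bary_leg\<close> sends to
      the edge point with coordinates \<open>p\<close>, \<open>q\<close>.\<close>
    define c where "c = \<mu>\<^sup>2 / (5 + \<mu>\<^sup>2)"
    define d where "d = (p - q) * half_chord c"
    define a b where "a = (1 - c + d) / 2" "b = (1 - c - d) / 2"
    have c: "0 < c" "c < 1/6" using \<mu>2 by (auto simp: c_def field_simps add_pos_pos)
    have h: "half_chord c > 0" using c by (intro half_chord_pos) auto
    have s: "a + b + c = 1" by (simp add: a_b_def field_simps)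
    have ab: "a - b = d" by (simp add: a_b_def field_simps)
    have d2: "d\<^sup>2 \<le> c * (2 - 3 * c)"
    proof -
      have "\<bar>p - q\<bar> \<le> 1" using assms by auto
      then have "(p - q)\<^sup>2 \<le> 1" by (simp add: abs_square_le_1)
      then have "(p - q)\<^sup>2 * (half_chord c)\<^sup>2 \<le> 1 * (half_chord c)\<^sup>2" by (intro mult_right_mono) auto
      then show ?thesis using half_chord_sq[of c] c by (simp add: d_def power_mult_distrib)
    qed
    \<comment> \<open>The two sides differ by the square of \<open>1 - 2 * c\<close>. Strictness
      keeps \<open>a\<close> and \<open>b\<close> positive, away from the points of
      tangency.\<close>
    have "c * (2 - 3 * c) < (1 - c)\<^sup>2"
    proof -
      have "(1 - 2 * c)\<^sup>2 > 0" using c by auto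
      then show ?thesis by (simp add: power2_eq_square algebra_simps)
    qed
    then have "\<bar>d\<bar> < 1 - c" using d2 c by (intro power2_less_imp_less[of "\<bar>d\<bar>"]) auto
    then have "a > 0" "b > 0" by (auto simp: a_b_def)
    moreover have "a\<^sup>2 + b\<^sup>2 + c\<^sup>2 \<le> 1/2"
      using chord_identity[OF s] d2 ab by auto
    ultimately have D: "disc_coords a b c" using c s by (auto simp: disc_coords_def)
    have ge: "a \<ge> 1/6" "b \<ge> 1/6" using disc_coords_legs_disjoint[OF D] c by auto
    have "5 + \<mu>\<^sup>2 > 0" by (simp add: add_pos_nonneg)
    then have "1 - c = 5 / (5 + \<mu>\<^sup>2)" by (simp add: c_def diff_divide_eq_iff)
    then have "5 * c / (1 - c) = \<mu>\<^sup>2" using \<open>5 + \<mu>\<^sup>2 > 0\<close> by (simp add: c_def)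
    then have mc: "leg_modulus c = \<mu>" using assms \<mu> by (simp add: leg_modulus_def)
    have "bary a b c = 1/2 + (p - q) / 2" "bary b a c = 1/2 - (p - q) / 2" "bary c a b = 0"
      using bary_leg[OF D] c h ab by (auto simp: d_def)
    then have "bary a b c = p" "bary b a c = q" "bary c a b = r"
      using assms(4) r by (auto simp: field_simps)
    moreover have "leg_modulus a = 1" "leg_modulus b = 1"
      using ge disc_coords_bounds[OF D] leg_modulus_eq_one by blast+
    ultimately show ?thesis
      using D mc by blast
  qed
qed

section \<open>Points of the line as triangles\<close>

definition side_sum :: "complex \<times> complex \<Rightarrow> real" where
  "side_sum P = 1 + (cmod (fst P))\<^sup>2 + (cmod (snd P))\<^sup>2"

definition side0 :: "complex \<times> complex \<Rightarrow> real" where "side0 P = 1 / side_sum P"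
definition side1 :: "complex \<times> complex \<Rightarrow> real" where "side1 P = (cmod (fst P))\<^sup>2 / side_sum P"
definition side2 :: "complex \<times> complex \<Rightarrow> real" where "side2 P = (cmod (snd P))\<^sup>2 / side_sum P"

lemma side_sum_pos: "side_sum P > 0"
  by (simp add: side_sum_def add_pos_nonneg)

lemma H_iff: "P \<in> H \<longleftrightarrow> fst P \<noteq> 0 \<and> snd P \<noteq> 0 \<and> snd P = - 1 - fst P"
proof -
  have "1 + fst P + snd P = 0 \<longleftrightarrow> snd P = - 1 - fst P"
    by (metis add.commute add_eq_0_iff diff_conv_add_uminus minus_add_distrib)
  then show ?thesis by (cases P) (auto simp: H_def torus2_def)
qed

lemma H_cartesian:
  assumes "P \<in> H"
  shows "Re (snd P) = - 1 - Re (fst P)" "Im (snd P) = - Im (fst P)"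
    and "(cmod (snd P))\<^sup>2 = (1 + Re (fst P))\<^sup>2 + (Im (fst P))\<^sup>2"
proof -
  have e: "snd P = - 1 - fst P" using assms by (simp add: H_iff)
  show "Re (snd P) = - 1 - Re (fst P)" "Im (snd P) = - Im (fst P)" by (simp_all add: e)
  show "(cmod (snd P))\<^sup>2 = (1 + Re (fst P))\<^sup>2 + (Im (fst P))\<^sup>2"
    unfolding cmod_power2 e by (simp add: power2_eq_square algebra_simps)
qed

lemma sides_sum: "side0 P + side1 P + side2 P = 1"
  using side_sum_pos[of P] by (simp add: side0_def side1_def side2_def field_simps) (simp add: side_sum_def)

text \<open>Twice the area of the triangle is \<open>\<bar>Im (fst P)\<bar>\<close>, the height over
  the side of length 1; this is Heron's formula divided by the square of
  \<open>side_sum P\<close>.\<close>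

lemma sides_sum_squares:
  assumes "P \<in> H"
  shows "(side0 P)\<^sup>2 + (side1 P)\<^sup>2 + (side2 P)\<^sup>2 = 1/2 - 2 * (Im (fst P) * side0 P)\<^sup>2"
proof -
  define x y S where "x = Re (fst P)" "y = Im (fst P)" "S = side_sum P"
  have c: "(cmod (fst P))\<^sup>2 = x\<^sup>2 + y\<^sup>2" "(cmod (snd P))\<^sup>2 = (1 + x)\<^sup>2 + y\<^sup>2"
    using H_cartesian(3)[OF assms] by (simp_all add: x_y_S_def cmod_power2)
  have S: "S = 2 * (1 + x + x\<^sup>2 + y\<^sup>2)"
    unfolding x_y_S_def(3) side_sum_def c by (simp add: power2_eq_square algebra_simps)
  have S0: "S > 0" using side_sum_pos[of P] by (simp add: x_y_S_def)
  have "(side0 P)\<^sup>2 + (side1 P)\<^sup>2 + (side2 P)\<^sup>2 = (1 + (x\<^sup>2 + y\<^sup>2)\<^sup>2 + ((1 + x)\<^sup>2 + y\<^sup>2)\<^sup>2) / S\<^sup>2"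
    unfolding side0_def side1_def side2_def c x_y_S_def(3) power_divide by (simp add: add_divide_distrib)
  also have "1 + (x\<^sup>2 + y\<^sup>2)\<^sup>2 + ((1 + x)\<^sup>2 + y\<^sup>2)\<^sup>2 = S\<^sup>2 / 2 - 2 * y\<^sup>2"
    unfolding S by (simp add: power2_eq_square algebra_simps)
  also have "\<dots> / S\<^sup>2 = 1/2 - 2 * (y * (1 / S))\<^sup>2"
    using S0 by (simp add: field_simps)
  finally show ?thesis by (simp add: x_y_S_def side0_def)
qed

lemma H_disc_coords:
  assumes "P \<in> H" shows "disc_coords (side0 P) (side1 P) (side2 P)"
  using assms sides_sum_squares[OF assms] side_sum_pos[of P] sides_sum[of P]
  by (auto simp: disc_coords_def H_iff side0_def side1_def side2_def)

lemma H_real_iff: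
  assumes "P \<in> H"
  shows "Im (fst P) = 0 \<longleftrightarrow> (side0 P)\<^sup>2 + (side1 P)\<^sup>2 + (side2 P)\<^sup>2 = 1/2"
  using sides_sum_squares[OF assms] side_sum_pos[of P] by (auto simp: side0_def)

text \<open>The moduli of \<open>z\<close> and \<open>1 + z\<close> give the real part of
  \<open>z\<close>, hence \<open>z\<close> up to conjugation; the last hypothesis selects the half
  plane.\<close>

lemma H_eqI:
  assumes "P \<in> H" "Q \<in> H" "cmod (fst P) = cmod (fst Q)" "cmod (snd P) = cmod (snd Q)"
    and "Im (fst P) * Im (fst Q) \<ge> 0"
  shows "P = Q"
proof -
  define x y x' y' where "x = Re (fst P)" "y = Im (fst P)" "x' = Re (fst Q)" "y' = Im (fst Q)"
  have 1: "x\<^sup>2 + y\<^sup>2 = x'\<^sup>2 + y'\<^sup>2"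
    using assms(3) by (simp add: x_y_x'_y'_def flip: cmod_power2)
  have 2: "(1 + x)\<^sup>2 + y\<^sup>2 = (1 + x')\<^sup>2 + y'\<^sup>2"
    using H_cartesian(3)[OF assms(1)] H_cartesian(3)[OF assms(2)] assms(4)
    by (simp add: x_y_x'_y'_def)
  from 1 2 have x: "x = x'" by (simp add: power2_eq_square algebra_simps)
  with 1 have "y\<^sup>2 = y'\<^sup>2" by simp
  then have "y = y' \<or> y = - y'" by (simp add: power2_eq_iff)
  moreover have "y * y' \<ge> 0" using assms by (simp add: x_y_x'_y'_def)
  ultimately have "y = y'" by (auto simp: mult_le_0_iff)
  with x have "fst P = fst Q" by (simp add: x_y_x'_y'_def complex_eq_iff)
  then show ?thesis using assms(1,2) by (simp add: H_iff prod_eq_iff)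
qed

lemma sides_determine_moduli:
  assumes "side0 P = side0 Q" "side1 P = side1 Q" "side2 P = side2 Q"
  shows "cmod (fst P) = cmod (fst Q)" "cmod (snd P) = cmod (snd Q)"
  using assms side_sum_pos[of P] side_sum_pos[of Q] by (auto simp: side0_def side1_def side2_def)

lemma H_realize:
  assumes "disc_coords a b c" "\<sigma> = 1 \<or> \<sigma> = - 1"
  shows "\<exists>P\<in>H. side0 P = a \<and> side1 P = b \<and> side2 P = c \<and> \<sigma> * Im (fst P) \<ge> 0"
proof -
  define y where "y = sqrt (1 - 2 * (a\<^sup>2 + b\<^sup>2 + c\<^sup>2))"
  have pos: "a > 0" "b > 0" "c > 0" and s: "a + b + c = 1" and y2: "y\<^sup>2 = 1 - 2 * (a\<^sup>2 + b\<^sup>2 + c\<^sup>2)" "y \<ge> 0"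
    using assms by (auto simp: disc_coords_def y_def)
  have \<sigma>: "\<sigma>\<^sup>2 = 1" using assms(2) by auto
  \<comment> \<open>The real part comes from the law of cosines for squared sides 1,
    \<open>b / a\<close>, \<open>c / a\<close>. By Heron \<open>y\<close> is four times the area for
    squared sides \<open>a\<close>, \<open>b\<close>, \<open>c\<close>, so after scaling the first
    side to 1 the height is \<open>y / (2 * a)\<close>.\<close>
  define z where "z = Complex ((c - b - a) / (2 * a)) (\<sigma> * y / (2 * a))"
  have c: "c = 1 - a - b" using s by simp
  have "(cmod z)\<^sup>2 = ((c - b - a)\<^sup>2 + y\<^sup>2) / (4 * a\<^sup>2)"
    using \<sigma> by (simp add: z_def cmod_power2 power_divide power_mult_distrib add_divide_distrib)
  also have "(c - b - a)\<^sup>2 + y\<^sup>2 = 4 * a * b"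
    unfolding y2 c by (simp add: power2_eq_square algebra_simps)
  finally have z1: "(cmod z)\<^sup>2 = b / a" using pos by (simp add: power2_eq_square field_simps)
  have "- 1 - z = - Complex ((c - b + a) / (2 * a)) (\<sigma> * y / (2 * a))"
    using pos by (simp add: z_def complex_eq_iff field_simps)
  then have "cmod (- 1 - z) = cmod (Complex ((c - b + a) / (2 * a)) (\<sigma> * y / (2 * a)))"
    by (simp only: norm_minus_cancel)
  then have "(cmod (- 1 - z))\<^sup>2 = ((c - b + a) / (2 * a))\<^sup>2 + (\<sigma> * y / (2 * a))\<^sup>2"
    by (simp only: cmod_power2 complex.sel)
  also have "\<dots> = ((c - b + a)\<^sup>2 + y\<^sup>2) / (4 * a\<^sup>2)"
    unfolding power_divide power_mult_distrib \<sigma> by (simp add: add_divide_distrib)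
  also have "(c - b + a)\<^sup>2 + y\<^sup>2 = 4 * a * c"
    unfolding y2 c by (simp add: power2_eq_square algebra_simps)
  finally have z2: "(cmod (- 1 - z))\<^sup>2 = c / a" using pos by (simp add: power2_eq_square field_simps)
  have S: "side_sum (z, - 1 - z) = 1 / a"
    using pos s by (simp add: side_sum_def z1 z2 field_simps)
  have "z \<noteq> 0" "- 1 - z \<noteq> 0" using z1 z2 pos by force+
  then have "(z, - 1 - z) \<in> H" by (simp add: H_iff)
  moreover have "\<sigma> * Im z \<ge> 0"
    using \<sigma> y2 pos by (simp add: z_def power2_eq_square flip: mult.assoc)
  ultimately show ?thesis
    using pos by (intro bexI[of _ "(z, - 1 - z)"]) (auto simp: side0_def side1_def side2_def S z1 z2)
qed

section \<open>Angles and limiting phases\<close>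

definition bary0 :: "complex \<times> complex \<Rightarrow> real" where "bary0 P = bary (side0 P) (side1 P) (side2 P)"
definition bary1 :: "complex \<times> complex \<Rightarrow> real" where "bary1 P = bary (side1 P) (side0 P) (side2 P)"
definition bary2 :: "complex \<times> complex \<Rightarrow> real" where "bary2 P = bary (side2 P) (side0 P) (side1 P)"

lemma barys_sum: "bary0 P + bary1 P + bary2 P = 1"
  unfolding bary0_def bary1_def bary2_def by (rule bary_sum) (rule sides_sum)

lemma barys_nonneg:
  assumes "P \<in> H" shows "bary0 P \<ge> 0" "bary1 P \<ge> 0" "bary2 P \<ge> 0"
  unfolding bary0_def bary1_def bary2_def
  using H_disc_coords[OF assms] disc_coords_swap bary_nonneg by metis+

text \<open>The directions of the second and third side of a triangle with first side 1, orientation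
  \<open>\<sigma>\<close>, and angles \<open>pi * p1\<close> and \<open>pi * p2\<close> opposite to
  those two sides.\<close>

definition phases :: "real \<Rightarrow> real \<Rightarrow> real \<Rightarrow> complex \<times> complex" where
  "phases \<sigma> p1 p2 = (- cis (- (\<sigma> * pi * p2)), - cis (\<sigma> * pi * p1))"

text \<open>At real points both signs give the same value, see \<open>phases_real\<close>; hence the
  definition is continuous across the real locus.\<close>

definition limit_phase :: "complex \<times> complex \<Rightarrow> complex \<times> complex" where
  "limit_phase P = phases (if Im (fst P) \<ge> 0 then 1 else - 1) (bary1 P) (bary2 P)"

text \<open>The three intervals of the real locus differ in which side of the degenerate triangle is
  longest, and the longest side names the vertex.\<close>

lemma H_real_bary:
  assumes P: "P \<in> H" and im: "Im (fst P) = 0"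
  shows "Re (fst P) > 0 \<Longrightarrow> bary2 P = 1 \<and> bary1 P = 0 \<and> bary0 P = 0"
    and "Re (snd P) > 0 \<Longrightarrow> bary1 P = 1 \<and> bary2 P = 0 \<and> bary0 P = 0"
    and "Re (fst P) < 0 \<Longrightarrow> Re (snd P) < 0 \<Longrightarrow> bary0 P = 1 \<and> bary1 P = 0 \<and> bary2 P = 0"
proof -
  note D = H_disc_coords[OF P] and S = side_sum_pos[of P]
  have "bary0 P = 1 \<or> bary1 P = 1 \<or> bary2 P = 1"
    using bary_vertex_iff[OF D] H_real_iff[OF P] im by (simp add: bary0_def bary1_def bary2_def)
  then have v: "bary0 P = 1 \<and> bary1 P = 0 \<and> bary2 P = 0 \<or> bary0 P = 0 \<and> bary1 P = 1 \<and> bary2 P = 0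
     \<or> bary0 P = 0 \<and> bary1 P = 0 \<and> bary2 P = 1"
    using barys_sum[of P] barys_nonneg[OF P] by linarith
  define x where "x = Re (fst P)"
  have sq: "(cmod (fst P))\<^sup>2 = x\<^sup>2" "(cmod (snd P))\<^sup>2 = (1 + x)\<^sup>2" and re: "Re (snd P) = - 1 - x"
    using im H_cartesian[OF P] by (simp_all add: x_def cmod_power2)
  \<comment> \<open>A normalised square of at least 1/2 means that this squared side is at least the
    sum of the other two; the next three facts solve these inequalities for
    \<open>x\<close>.\<close>
  have 0: "x\<^sup>2 + (1 + x)\<^sup>2 \<le> 1" if "bary0 P = 1"
    using bary_eq_one_imp_ge_half[OF D] that S sq by (simp add: bary0_def side0_def field_simps side_sum_def)
  have 1: "1 + (1 + x)\<^sup>2 \<le> x\<^sup>2" if "bary1 P = 1"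
    using bary_eq_one_imp_ge_half[OF disc_coords_swap(1)[OF D]] that S sq
    by (simp add: bary1_def side1_def field_simps side_sum_def)
  have 2: "1 + x\<^sup>2 \<le> (1 + x)\<^sup>2" if "bary2 P = 1"
    using bary_eq_one_imp_ge_half[OF disc_coords_swap(3)[OF D]] that S sq
    by (simp add: bary2_def side2_def field_simps side_sum_def)
  have 0: "x * (1 + x) \<le> 0" if "bary0 P = 1"
    using 0[OF that] by (simp add: power2_eq_square algebra_simps)
  have 1: "x \<le> - 1" if "bary1 P = 1"
    using 1[OF that] by (simp add: power2_eq_square algebra_simps)
  have 2: "x \<ge> 0" if "bary2 P = 1"
    using 2[OF that] by (simp add: power2_eq_square algebra_simps)
  show "bary2 P = 1 \<and> bary1 P = 0 \<and> bary0 P = 0" if "Re (fst P) > 0"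
    using v 0 1 2 that by (auto simp: mult_le_0_iff simp flip: x_def)
  show "bary1 P = 1 \<and> bary2 P = 0 \<and> bary0 P = 0" if "Re (snd P) > 0"
    using v 0 1 2 that by (auto simp: mult_le_0_iff re)
  show "bary0 P = 1 \<and> bary1 P = 0 \<and> bary2 P = 0" if "Re (fst P) < 0" "Re (snd P) < 0"
    using v 0 1 2 that by (auto simp: re simp flip: x_def)
qed

lemma cis_minus_pi: "cis (- pi) = - 1"
  by (simp add: complex_eq_iff)

lemma sgn_real_complex: "Im z = 0 \<Longrightarrow> sgn z = of_real (sgn (Re z))"
  by (metis complex_is_Real_iff of_real_Re sgn_of_real)

text \<open>At a vertex all angles are 0 or pi, so \<open>\<sigma>\<close> drops out and only signs
  remain; they are those of the coordinates. A real point thus has its limiting phases from the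
  start.\<close>

lemma phases_real:
  assumes P: "P \<in> H" and im: "Im (fst P) = 0" and \<sigma>: "\<sigma> = 1 \<or> \<sigma> = - 1"
  shows "phases \<sigma> (bary1 P) (bary2 P) = (sgn (fst P), sgn (snd P))"
proof -
  have im2: "Im (snd P) = 0" and re: "Re (snd P) = - 1 - Re (fst P)" using H_cartesian[OF P] im by auto
  have "Re (fst P) \<noteq> 0" "Re (snd P) \<noteq> 0" using P im im2 by (auto simp: H_iff complex_eq_iff)
  then consider "Re (fst P) > 0" | "Re (snd P) > 0" | "Re (fst P) < 0" "Re (snd P) < 0" by linarith
  then show ?thesis
  proof cases
    case 1
    then show ?thesis using H_real_bary(1)[OF P im 1] re \<sigma> im im2
      by (auto simp: phases_def sgn_real_complex cis_minus_pi)
  next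
    case 2
    then show ?thesis using H_real_bary(2)[OF P im 2] re \<sigma> im im2
      by (auto simp: phases_def sgn_real_complex cis_minus_pi)
  next
    case 3
    then show ?thesis using H_real_bary(3)[OF P im 3] re \<sigma> im im2
      by (auto simp: phases_def sgn_real_complex cis_minus_pi)
  qed
qed

lemma limit_phase_real:
  assumes "P \<in> H" "Im (fst P) = 0"
  shows "limit_phase P = (sgn (fst P), sgn (snd P))"
  unfolding limit_phase_def using assms by (intro phases_real) auto

lemma limit_phase_eq:
  assumes "P \<in> H" "\<sigma> = 1 \<or> \<sigma> = - 1" "\<sigma> * Im (fst P) \<ge> 0"
  shows "limit_phase P = phases \<sigma> (bary1 P) (bary2 P)"
proof (cases "Im (fst P) = 0")
  case True
  then show ?thesis using phases_real limit_phase_real assms by metis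
next
  case False
  then show ?thesis using assms by (auto simp: limit_phase_def)
qed

lemma continuous_on_half_chord [continuous_intros]:
  "continuous_on S f \<Longrightarrow> continuous_on S (\<lambda>x. half_chord (f x))"
  unfolding half_chord_def by (intro continuous_intros)

lemma continuous_on_sides:
  "continuous_on S side0" "continuous_on S side1" "continuous_on S side2"
proof -
  have c: "continuous_on S side_sum" unfolding side_sum_def by (intro continuous_intros)
  have n: "\<forall>P\<in>S. side_sum P \<noteq> 0" using side_sum_pos by (metis less_irrefl)
  show "continuous_on S side0" "continuous_on S side1" "continuous_on S side2"
    unfolding side0_def side1_def side2_def using c n by (auto intro!: continuous_intros)
qed

text \<open>Positivity of the last two arguments keeps \<open>stretch\<close> away from the zero of
  \<open>half_chord\<close> at 0.\<close>

lemma continuous_on_bary: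
  fixes f g h :: "'a::topological_space \<Rightarrow> real"
  assumes "continuous_on S f" "continuous_on S g" "continuous_on S h"
    and "\<And>x. x \<in> S \<Longrightarrow> g x > 0" "\<And>x. x \<in> S \<Longrightarrow> h x > 0"
  shows "continuous_on S (\<lambda>x. bary (f x) (g x) (h x))"
proof -
  have "half_chord (min y (1/6)) \<noteq> 0" if "y > 0" for y
    using half_chord_pos[of "min y (1/6)"] that by (auto simp: min_def split: if_splits)
  then show ?thesis
    unfolding bary_def stretch_def using assms by (intro continuous_intros) auto
qed

lemma continuous_on_barys: "continuous_on H bary1" "continuous_on H bary2"
  unfolding bary1_def bary2_def
  using disc_coords_bounds[OF H_disc_coords]
  by (auto intro!: continuous_on_bary continuous_on_sides)

text \<open>Pasting of two formulas along the real locus, which belongs to both closed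
  halves.\<close>

lemma continuous_on_limit_phase: "continuous_on H limit_phase"
proof -
  let ?A = "{P \<in> H. Im (fst P) \<ge> 0}" and ?B = "{P \<in> H. Im (fst P) \<le> 0}"
  have cl: "closedin (top_of_set H) ?A" "closedin (top_of_set H) ?B"
    unfolding Collect_conj_eq Collect_mem_eq
    by (auto intro!: closedin_closed_Int closed_Collect_le continuous_intros)
  have c: "continuous_on X (\<lambda>P. phases \<sigma> (bary1 P) (bary2 P))" if "X \<subseteq> H" for X \<sigma>
    unfolding phases_def cis_conv_exp
    by (intro continuous_intros continuous_on_subset[OF continuous_on_barys(1) that]
        continuous_on_subset[OF continuous_on_barys(2) that])
  have "continuous_on ?A limit_phase"
    by (rule continuous_on_eq[OF c[of _ 1]]) (auto simp: limit_phase_eq[of _ 1])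
  moreover have "continuous_on ?B limit_phase"
    by (rule continuous_on_eq[OF c[of _ "- 1"]]) (auto simp: limit_phase_eq[of _ "- 1"])
  moreover have "?A \<union> ?B = H" by auto
  ultimately show ?thesis
    using continuous_on_Un_local[of ?A ?B limit_phase] cl by simp
qed

section \<open>The isotopy\<close>

lemma leg_modulus_sq_bounds:
  assumes "0 < x" "x < 1" shows "x \<le> (leg_modulus x)\<^sup>2" "(leg_modulus x)\<^sup>2 \<le> 6 * x"
proof -
  have "x \<le> 5 * x / (1 - x)" using assms by (simp add: field_simps)
  then show "x \<le> (leg_modulus x)\<^sup>2" using assms by (simp add: leg_modulus_sq)
  show "(leg_modulus x)\<^sup>2 \<le> 6 * x"
  proof (cases "x \<ge> 1/6")
    case False
    then have "5 * x / (1 - x) \<le> 6 * x" using assms by (simp add: field_simps)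
    then show ?thesis using assms by (simp add: leg_modulus_sq)
  qed (use assms in \<open>simp add: leg_modulus_sq\<close>)
qed

text \<open>The quotients \<open>(leg_modulus a)\<^sup>2 / a\<close> and
  \<open>(leg_modulus b)\<^sup>2 / b\<close> lie between 1 and 6, and the squared expression is the
  second over the first. Passing from the square to the weaker bounds here avoids roots.\<close>

lemma leg_modulus_ratio_bounds:
  assumes "0 < a" "a < 1" "0 < b" "b < 1" "r > 0" "r\<^sup>2 = b / a"
  shows "1/6 \<le> leg_modulus b / (leg_modulus a * r)" "leg_modulus b / (leg_modulus a * r) \<le> 6"
proof -
  note A = leg_modulus_sq_bounds[OF assms(1,2)] and B = leg_modulus_sq_bounds[OF assms(3,4)]
  define q where "q = leg_modulus b / (leg_modulus a * r)"
  have q: "q > 0" using assms by (simp add: q_def leg_modulus_pos)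
  have pos: "(leg_modulus a)\<^sup>2 > 0" using leg_modulus_pos[OF assms(1,2)] by simp
  have q2: "q\<^sup>2 = ((leg_modulus b)\<^sup>2 * a) / ((leg_modulus a)\<^sup>2 * b)"
    using assms by (simp add: q_def power_divide power_mult_distrib)
  have "(leg_modulus b)\<^sup>2 * a \<le> (6 * b) * (leg_modulus a)\<^sup>2"
    using A B assms by (intro mult_mono) auto
  then have "q\<^sup>2 \<le> 6" unfolding q2 using assms pos by (simp add: divide_le_eq algebra_simps)
  then have "q \<le> 6" by (intro power2_le_imp_le[of q 6]) auto
  have "b * (leg_modulus a)\<^sup>2 \<le> (leg_modulus b)\<^sup>2 * (6 * a)"
    using A B assms by (intro mult_mono) auto
  then have "1/6 \<le> q\<^sup>2" unfolding q2 using assms pos by (simp add: le_divide_eq algebra_simps)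
  then have "1/6 \<le> q" using q by (intro power2_le_imp_le[of "1/6" q]) (auto simp: power2_eq_square)
  with \<open>q \<le> 6\<close> show "1/6 \<le> leg_modulus b / (leg_modulus a * r)" "leg_modulus b / (leg_modulus a * r) \<le> 6"
    by (simp_all add: q_def)
qed

definition modulus0 :: "complex \<times> complex \<Rightarrow> real" where "modulus0 P = leg_modulus (side0 P)"
definition modulus1 :: "complex \<times> complex \<Rightarrow> real" where "modulus1 P = leg_modulus (side1 P)"
definition modulus2 :: "complex \<times> complex \<Rightarrow> real" where "modulus2 P = leg_modulus (side2 P)"

text \<open>The factor by which \<open>isotopy\<close> has changed the modulus at time 1. The three
  moduli are homogeneous coordinates; dividing by \<open>modulus0\<close> makes them affine.\<close>

definition ratio1 :: "complex \<times> complex \<Rightarrow> real" where "ratio1 P = modulus1 P / (modulus0 P * cmod (fst P))"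
definition ratio2 :: "complex \<times> complex \<Rightarrow> real" where "ratio2 P = modulus2 P / (modulus0 P * cmod (snd P))"

lemma sides_bounds:
  assumes "P \<in> H" shows "0 < side0 P" "side0 P < 1" "0 < side1 P" "side1 P < 1" "0 < side2 P" "side2 P < 1"
  using disc_coords_bounds[OF H_disc_coords[OF assms]] by auto

lemma modulus_pos: assumes "P \<in> H" shows "modulus0 P > 0" "modulus1 P > 0" "modulus2 P > 0"
  using sides_bounds[OF assms] by (auto simp: modulus0_def modulus1_def modulus2_def leg_modulus_pos)

lemma cmod_pos: assumes "P \<in> H" shows "cmod (fst P) > 0" "cmod (snd P) > 0"
  using assms by (auto simp: H_iff)

lemma ratio_bounds:
  assumes "P \<in> H" shows "1/6 \<le> ratio1 P" "ratio1 P \<le> 6" "1/6 \<le> ratio2 P" "ratio2 P \<le> 6"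
proof -
  have "(cmod (fst P))\<^sup>2 = side1 P / side0 P" "(cmod (snd P))\<^sup>2 = side2 P / side0 P"
    using side_sum_pos[of P] by (auto simp: side0_def side1_def side2_def)
  then show "1/6 \<le> ratio1 P" "ratio1 P \<le> 6" "1/6 \<le> ratio2 P" "ratio2 P \<le> 6"
    unfolding ratio1_def ratio2_def modulus0_def modulus1_def modulus2_def
    using sides_bounds[OF assms] cmod_pos[OF assms] leg_modulus_ratio_bounds by blast+
qed

section \<open>Interpolation of the phases\<close>

definition mix_phase :: "real \<Rightarrow> complex \<Rightarrow> complex \<Rightarrow> complex" where
  "mix_phase t a b = of_real (1 - t) * sgn a + of_real t * b"

lemma mix_phase_real: "b = sgn a \<Longrightarrow> mix_phase t a b = sgn a"
  by (simp add: mix_phase_def algebra_simps)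

lemma mix_phase_Im:
  assumes "0 \<le> t" "t < 1" "Im a \<noteq> 0" "Im a * Im b \<ge> 0"
  shows "Im a * Im (mix_phase t a b) > 0"
proof -
  have "Im a * Im (mix_phase t a b) = (1 - t) * (Im a * Im a / cmod a) + t * (Im a * Im b)"
    by (simp add: mix_phase_def Im_sgn algebra_simps diff_divide_distrib)
  moreover have "(1 - t) * (Im a * Im a / cmod a) > 0"
    using assms by (intro mult_pos_pos[of "1 - t"] divide_pos_pos) (auto simp: zero_less_mult_iff)
  ultimately show ?thesis using assms by (simp add: add_pos_nonneg)
qed

text \<open>Off the real line and before time 1 the segment from \<open>sgn a\<close> to
  \<open>b\<close> stays in the open half plane of \<open>a\<close>. For real \<open>a\<close> it is
  constant, and at time 1 it is \<open>b\<close>.\<close>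

lemma mix_phase_nonzero:
  assumes "0 \<le> t" "t \<le> 1" "a \<noteq> 0" "b \<noteq> 0" "Im a * Im b \<ge> 0" "Im a = 0 \<Longrightarrow> b = sgn a"
  shows "mix_phase t a b \<noteq> 0"
proof (cases "Im a = 0 \<or> t = 1")
  case True
  then show ?thesis using assms mix_phase_real[of b a t] by (auto simp: mix_phase_def sgn_zero_iff)
next
  case False
  then show ?thesis using mix_phase_Im[of t a b] assms by force
qed

lemma phases_norm: "cmod (fst (phases \<sigma> p q)) = 1" "cmod (snd (phases \<sigma> p q)) = 1"
  by (simp_all add: phases_def)

lemma limit_phase_norm: "cmod (fst (limit_phase P)) = 1" "cmod (snd (limit_phase P)) = 1"
  by (simp_all add: limit_phase_def phases_norm)

lemma limit_phase_nonzero: "fst (limit_phase P) \<noteq> 0" "snd (limit_phase P) \<noteq> 0"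
  using limit_phase_norm[of P] by force+

lemma barys_le_one:
  assumes "P \<in> H" shows "bary1 P \<le> 1" "bary2 P \<le> 1"
  using barys_sum[of P] barys_nonneg[OF assms] by auto

lemma sin_pi_bary_nonneg:
  assumes "P \<in> H" shows "sin (pi * bary1 P) \<ge> 0" "sin (pi * bary2 P) \<ge> 0"
  using barys_nonneg[OF assms] barys_le_one[OF assms] by (auto intro!: sin_ge_zero simp: mult_left_le)

text \<open>The orientation is the sign of \<open>Im (fst P)\<close>, and \<open>snd P\<close> has
  the opposite imaginary part, in accordance with the opposite signs of the angles in
  \<open>phases\<close>.\<close>

lemma limit_phase_Im:
  assumes "P \<in> H"
  shows "Im (fst P) * Im (fst (limit_phase P)) \<ge> 0" "Im (snd P) * Im (snd (limit_phase P)) \<ge> 0"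
  using sin_pi_bary_nonneg[OF assms] H_cartesian(2)[OF assms]
  by (auto simp: limit_phase_def phases_def mult_nonneg_nonneg mult_nonpos_nonneg)

lemma mix_limit_phase_nonzero:
  assumes "P \<in> H" "0 \<le> t" "t \<le> 1"
  shows "mix_phase t (fst P) (fst (limit_phase P)) \<noteq> 0"
    and "mix_phase t (snd P) (snd (limit_phase P)) \<noteq> 0"
proof -
  have nz: "fst P \<noteq> 0" "snd P \<noteq> 0" using assms(1) H_iff by blast+
  have re: "Im (fst P) = 0 \<Longrightarrow> fst (limit_phase P) = sgn (fst P)"
    "Im (snd P) = 0 \<Longrightarrow> snd (limit_phase P) = sgn (snd P)"
    using limit_phase_real[OF assms(1)] H_cartesian(2)[OF assms(1)] by simp_all
  show "mix_phase t (fst P) (fst (limit_phase P)) \<noteq> 0"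
    and "mix_phase t (snd P) (snd (limit_phase P)) \<noteq> 0"
    using mix_phase_nonzero[OF assms(2,3) nz(1) limit_phase_nonzero(1) limit_phase_Im(1)[OF assms(1)] re(1)]
      mix_phase_nonzero[OF assms(2,3) nz(2) limit_phase_nonzero(2) limit_phase_Im(2)[OF assms(1)] re(2)]
    by blast+
qed

definition isotopy :: "(complex \<times> complex) \<times> real \<Rightarrow> complex \<times> complex" where
  "isotopy = (\<lambda>(P, t).
     (of_real (cmod (fst P) * ratio1 P powr t) * sgn (mix_phase t (fst P) (fst (limit_phase P))),
      of_real (cmod (snd P) * ratio2 P powr t) * sgn (mix_phase t (snd P) (snd (limit_phase P)))))"

lemma ratio_pos: assumes "P \<in> H" shows "ratio1 P > 0" "ratio2 P > 0"
  using ratio_bounds[OF assms] by linarith+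

lemma isotopy_cmod:
  assumes "P \<in> H" "0 \<le> t" "t \<le> 1"
  shows "cmod (fst (isotopy (P, t))) = cmod (fst P) * ratio1 P powr t"
    and "cmod (snd (isotopy (P, t))) = cmod (snd P) * ratio2 P powr t"
  using mix_limit_phase_nonzero[OF assms] ratio_pos[OF assms(1)]
  by (simp_all add: isotopy_def norm_mult norm_sgn)

lemma isotopy_in_torus:
  assumes "P \<in> H" "0 \<le> t" "t \<le> 1" shows "isotopy (P, t) \<in> torus2"
proof -
  have "cmod (fst (isotopy (P, t))) > 0" "cmod (snd (isotopy (P, t))) > 0"
    using isotopy_cmod[OF assms] cmod_pos[OF assms(1)] ratio_pos[OF assms(1)] by auto
  then show ?thesis by (cases "isotopy (P, t)") (auto simp: torus2_def)
qed

lemma cmod_mult_sgn: "of_real (cmod w) * sgn w = w"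
  by (simp add: sgn_eq)

lemma isotopy_zero:
  assumes "P \<in> H" shows "isotopy (P, 0) = P"
  using ratio_pos[OF assms] by (simp add: isotopy_def mix_phase_def cmod_mult_sgn)

lemma continuous_on_leg_modulus:
  assumes "continuous_on S f" "\<And>x. x \<in> S \<Longrightarrow> f x < 1"
  shows "continuous_on S (\<lambda>x. leg_modulus (f x))"
  unfolding leg_modulus_def using assms by (intro continuous_intros) force+

lemma continuous_on_ratio: "continuous_on H ratio1" "continuous_on H ratio2"
proof -
  have m: "continuous_on H modulus0" "continuous_on H modulus1" "continuous_on H modulus2"
    unfolding modulus0_def modulus1_def modulus2_def using sides_bounds
    by (auto intro!: continuous_on_leg_modulus continuous_on_sides)
  show "continuous_on H ratio1" "continuous_on H ratio2"
    unfolding ratio1_def ratio2_def using modulus_pos cmod_pos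
    by (auto intro!: continuous_intros m) force+
qed

lemma continuous_on_isotopy: "continuous_on (H \<times> {0..1}) isotopy"
proof -
  have c: "continuous_on (H \<times> {0..1}) (\<lambda>x. f (fst x))" if "continuous_on H f" for f :: "_ \<Rightarrow> 'a::topological_space"
    by (rule continuous_on_compose2[OF that]) (auto intro!: continuous_intros)
  have id: "continuous_on H fst" "continuous_on H snd" by (intro continuous_intros)+
  note cont = c[OF id(1)] c[OF id(2)] c[OF continuous_on_ratio(1)] c[OF continuous_on_ratio(2)]
    c[OF continuous_on_fst[OF continuous_on_limit_phase]]
    c[OF continuous_on_snd[OF continuous_on_limit_phase]]
  have mix: "continuous_on (H \<times> {0..1}) (\<lambda>x. mix_phase (snd x) (fst (fst x)) (fst (limit_phase (fst x))))"
    "continuous_on (H \<times> {0..1}) (\<lambda>x. mix_phase (snd x) (snd (fst x)) (snd (limit_phase (fst x))))"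
    unfolding mix_phase_def by (intro continuous_intros cont; auto simp: H_iff)+
  show ?thesis
    unfolding isotopy_def case_prod_beta
    by (intro continuous_intros cont mix) (auto simp: mix_limit_phase_nonzero dest: ratio_pos)
qed

section \<open>Injectivity before time 1\<close>

text \<open>At an index where \<open>s i / r i\<close> is largest, the normalised square of \<open>s i\<close> is at least that of
  \<open>r i\<close>; there the equation bounds the logarithm of the quotient.\<close>

lemma scaled_log_le:
  fixes r s F G :: "'i \<Rightarrow> real"
  assumes I: "finite I" and t: "0 \<le> t" "t < 1"
    and pos: "\<And>i. i \<in> I \<Longrightarrow> r i > 0" "\<And>i. i \<in> I \<Longrightarrow> s i > 0"
    and mono: "\<And>i. i \<in> I \<Longrightarrow> (r i)\<^sup>2 / (\<Sum>j\<in>I. (r j)\<^sup>2) \<le> (s i)\<^sup>2 / (\<Sum>j\<in>I. (s j)\<^sup>2) \<Longrightarrow> F i \<le> G i"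
    and eq: "\<And>i. i \<in> I \<Longrightarrow> (1 - t) * ln (r i) + t * F i = (1 - t) * ln (s i) + t * G i + C"
    and i: "i \<in> I"
  shows "(1 - t) * (ln (s i) - ln (r i)) + C \<le> 0"
proof -
  have "finite ((\<lambda>i. s i / r i) ` I)" "(\<lambda>i. s i / r i) ` I \<noteq> {}" using I i by auto
  from Max_in[OF this] obtain j where j: "j \<in> I" "Max ((\<lambda>i. s i / r i) ` I) = s j / r j" by auto
  have max: "s k / r k \<le> s j / r j" if "k \<in> I" for k
    using Max_ge[OF \<open>finite ((\<lambda>i. s i / r i) ` I)\<close>, of "s k / r k"] that j by auto
  have "r j * s k \<le> s j * r k" if "k \<in> I" for k
    using max[OF that] pos[OF that] pos[OF j(1)] by (simp add: field_simps)
  then have "(r j * s k)\<^sup>2 \<le> (s j * r k)\<^sup>2" if "k \<in> I" for k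
    using that pos[OF that] pos[OF j(1)] by (intro power_mono) auto
  then have "(\<Sum>k\<in>I. (r j * s k)\<^sup>2) \<le> (\<Sum>k\<in>I. (s j * r k)\<^sup>2)" by (rule sum_mono)
  then have "(r j)\<^sup>2 * (\<Sum>k\<in>I. (s k)\<^sup>2) \<le> (s j)\<^sup>2 * (\<Sum>k\<in>I. (r k)\<^sup>2)"
    by (simp add: power_mult_distrib sum_distrib_left)
  moreover have "(\<Sum>k\<in>I. (s k)\<^sup>2) > 0" "(\<Sum>k\<in>I. (r k)\<^sup>2) > 0"
    using I i pos by (intro sum_pos zero_less_power; blast)+
  ultimately have "F j \<le> G j"
    by (intro mono[OF j(1)]) (simp add: divide_simps mult.commute)
  moreover have "(1 - t) * (ln (s j) - ln (r j)) + C = t * (F j - G j)"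
    using eq[OF j(1)] by (simp add: algebra_simps)
  ultimately have 1: "(1 - t) * (ln (s j) - ln (r j)) + C \<le> 0"
    using t by (simp add: mult_nonneg_nonpos)
  \<comment> \<open>By the choice of \<open>j\<close> the bound obtained at \<open>j\<close> passes
    to every index.\<close>
  have "ln (s i / r i) \<le> ln (s j / r j)"
    using max[OF i] pos[OF i] pos[OF j(1)] by simp
  then have "ln (s i) - ln (r i) \<le> ln (s j) - ln (r j)"
    using pos[OF i] pos[OF j(1)] by (simp add: ln_div)
  then have "(1 - t) * (ln (s i) - ln (r i)) \<le> (1 - t) * (ln (s j) - ln (r j))"
    using t by (intro mult_left_mono) auto
  with 1 show ?thesis by simp
qed

text \<open>Equal images give equal homogeneous triples of interpolated moduli, that is, equality up
  to a scale, whose logarithm is \<open>C\<close>. Applying \<open>scaled_log_le\<close> in both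
  directions turns the monotonicity of \<open>leg_modulus\<close> into equality.\<close>

lemma isotopy_moduli_determined:
  assumes P: "P \<in> H" and Q: "Q \<in> H" and t: "0 \<le> t" "t < 1"
    and eq: "isotopy (P, t) = isotopy (Q, t)"
  shows "cmod (fst P) = cmod (fst Q)" "cmod (snd P) = cmod (snd Q)"
proof -
  define r where "r P i = (if i = 0 then 1 else if i = 1 then cmod (fst P) else cmod (snd P))"
    for P :: "complex \<times> complex" and i :: nat
  define F where "F P i = (if i = 0 then ln (modulus0 P) else if i = 1 then ln (modulus1 P) else ln (modulus2 P))"
    for P :: "complex \<times> complex" and i :: nat
  define I where "I = {0, 1, 2 :: nat}"
  define C where "C = t * (ln (modulus0 P) - ln (modulus0 Q))"
  have ln_w: "ln (cmod (fst (isotopy (P, t)))) = (1 - t) * ln (cmod (fst P)) + t * ln (modulus1 P) - t * ln (modulus0 P)"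
       "ln (cmod (snd (isotopy (P, t)))) = (1 - t) * ln (cmod (snd P)) + t * ln (modulus2 P) - t * ln (modulus0 P)"
    if "P \<in> H" for P
  proof -
    have "ln (ratio1 P) = ln (modulus1 P) - ln (modulus0 P) - ln (cmod (fst P))"
      "ln (ratio2 P) = ln (modulus2 P) - ln (modulus0 P) - ln (cmod (snd P))"
      using modulus_pos[OF that] cmod_pos[OF that] by (simp_all add: ratio1_def ratio2_def ln_div ln_mult)
    note lr = this
    have "ln (cmod (fst (isotopy (P, t)))) = ln (cmod (fst P)) + t * ln (ratio1 P)"
       "ln (cmod (snd (isotopy (P, t)))) = ln (cmod (snd P)) + t * ln (ratio2 P)"
      using isotopy_cmod[OF that, of t] t cmod_pos[OF that] ratio_pos[OF that]
      by (simp_all add: ln_mult ln_powr)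
    then show "ln (cmod (fst (isotopy (P, t)))) = (1 - t) * ln (cmod (fst P)) + t * ln (modulus1 P) - t * ln (modulus0 P)"
       "ln (cmod (snd (isotopy (P, t)))) = (1 - t) * ln (cmod (snd P)) + t * ln (modulus2 P) - t * ln (modulus0 P)"
      unfolding lr by (simp_all add: algebra_simps)
  qed
  have rpos: "r P i > 0" if "P \<in> H" for P i using cmod_pos[OF that] by (auto simp: r_def)
  have sum: "(\<Sum>j\<in>I. (r P j)\<^sup>2) = side_sum P" for P by (simp add: I_def r_def side_sum_def)
  have mono: "F P i \<le> F Q i"
    if "P \<in> H" "Q \<in> H" "i \<in> I" "(r P i)\<^sup>2 / (\<Sum>j\<in>I. (r P j)\<^sup>2) \<le> (r Q i)\<^sup>2 / (\<Sum>j\<in>I. (r Q j)\<^sup>2)" for P Q i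
    using that sides_bounds[OF that(1)] sides_bounds[OF that(2)] leg_modulus_pos leg_modulus_mono
    unfolding sum by (auto simp: I_def r_def F_def side0_def side1_def side2_def modulus0_def modulus1_def modulus2_def)
  have eqs: "(1 - t) * ln (r P i) + t * F P i = (1 - t) * ln (r Q i) + t * F Q i + C" if "i \<in> I" for i
    using that ln_w[OF P] ln_w[OF Q] eq by (auto simp: I_def r_def F_def C_def algebra_simps)
  have "(1 - t) * (ln (r Q i) - ln (r P i)) + C = 0" if i: "i \<in> I" for i
  proof (rule antisym)
    show "(1 - t) * (ln (r Q i) - ln (r P i)) + C \<le> 0"
      by (rule scaled_log_le[of I t "r P" "r Q" "F P" "F Q"])
        (use P Q t rpos mono eqs i in \<open>auto simp: I_def\<close>)
    have "(1 - t) * (ln (r P i) - ln (r Q i)) + (- C) \<le> 0"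
      by (rule scaled_log_le[of I t "r Q" "r P" "F Q" "F P"])
        (use P Q t rpos mono eqs i in \<open>auto simp: I_def\<close>)
    then show "(1 - t) * (ln (r Q i) - ln (r P i)) + C \<ge> 0" by (simp add: algebra_simps)
  qed
  note z = this
  \<comment> \<open>At index 0 both lengths are 1, so only \<open>C\<close> remains; afterwards the
    factor \<open>1 - t > 0\<close> cancels.\<close>
  have "C = 0" using z[of 0] by (simp add: I_def r_def)
  then have l: "ln (r Q i) = ln (r P i)" if "i \<in> I" for i using z[OF that] t by auto
  show "cmod (fst P) = cmod (fst Q)" "cmod (snd P) = cmod (snd Q)"
    using l[of 1] l[of 2] cmod_pos[OF P] cmod_pos[OF Q] by (auto simp: I_def r_def)
qed

lemma isotopy_Im:
  assumes "P \<in> H" "0 \<le> t" "t < 1" "Im (fst P) \<noteq> 0"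
  shows "Im (fst P) * Im (fst (isotopy (P, t))) > 0"
proof -
  define w where "w = mix_phase t (fst P) (fst (limit_phase P))"
  have "Im (fst P) * Im w > 0"
    unfolding w_def using assms limit_phase_Im[OF assms(1)] by (intro mix_phase_Im) auto
  moreover have "Im (fst (isotopy (P, t))) = cmod (fst P) * ratio1 P powr t / cmod w * Im w"
    by (simp add: isotopy_def w_def Im_sgn)
  moreover have "cmod (fst P) * ratio1 P powr t / cmod w > 0"
    using cmod_pos[OF assms(1)] ratio_pos[OF assms(1)] mix_limit_phase_nonzero(1)[OF assms(1), of t] assms
    by (simp add: w_def)
  ultimately show ?thesis
    by (metis mult.left_commute mult_pos_pos)
qed

text \<open>The image fixes the moduli, hence the point up to conjugation, and imaginary parts keep
  their sign along the isotopy.\<close>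

lemma isotopy_inj_less_one:
  assumes "0 \<le> t" "t < 1" shows "inj_on (\<lambda>P. isotopy (P, t)) H"
proof (rule inj_onI)
  fix P Q assume PQ: "P \<in> H" "Q \<in> H" and eq: "isotopy (P, t) = isotopy (Q, t)"
  show "P = Q"
  proof (rule H_eqI[OF PQ isotopy_moduli_determined[OF PQ assms eq]])
    show "Im (fst P) * Im (fst Q) \<ge> 0"
      using isotopy_Im[OF PQ(1) assms] isotopy_Im[OF PQ(2) assms] eq
      by (cases "Im (fst P) = 0 \<or> Im (fst Q) = 0") (auto simp: zero_less_mult_iff mult_nonneg_nonneg mult_nonpos_nonpos)
  qed
qed

section \<open>Properness and the embedding property\<close>

lemma H_sublevel_compact:
  "compact {P. 1 + fst P + snd P = 0 \<and> e \<le> cmod (fst P) \<and> cmod (fst P) \<le> M \<and> e \<le> cmod (snd P) \<and> cmod (snd P) \<le> M}"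
    (is "compact ?K")
proof (rule compact_eq_bounded_closed[THEN iffD2, OF conjI])
  show "closed ?K"
    by (intro closed_Collect_conj closed_Collect_eq closed_Collect_le continuous_intros)
  have "?K \<subseteq> cball 0 M \<times> cball 0 M" by auto
  then show "bounded ?K"
    by (rule bounded_subset[rotated]) (intro bounded_Times bounded_cball)
qed

text \<open>A compact subset of the image is bounded and bounded away from the axes. Moduli change
  by a factor between 1/6 and 6 only, so its preimage lies in a compact part of \<open>H\<close>.
  Properness makes the map closed onto its image.\<close>

lemma isotopy_embedding:
  assumes t: "0 \<le> t" "t \<le> 1" and inj: "inj_on (\<lambda>P. isotopy (P, t)) H"
  shows "\<exists>g. homeomorphism H ((\<lambda>P. isotopy (P, t)) ` H) (\<lambda>P. isotopy (P, t)) g"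
proof -
  let ?f = "\<lambda>P. isotopy (P, t)"
  have cont: "continuous_on H ?f"
    by (rule continuous_on_compose2[OF continuous_on_isotopy]) (use t in \<open>auto intro!: continuous_intros\<close>)
  have proper: "compact (H \<inter> ?f -` K)" if K: "K \<subseteq> ?f ` H" "compact K" for K
  proof -
    have Kt: "K \<subseteq> torus2" using K isotopy_in_torus t by auto
    have "\<exists>M. \<forall>w\<in>K. norm (inverse (fst w)) \<le> M \<and> norm (inverse (snd w)) \<le> M \<and> norm (fst w) \<le> M \<and> norm (snd w) \<le> M"
    proof -
      \<comment> \<open>Including the inverses bounds the moduli from below as well.\<close>
      have "continuous_on K (\<lambda>w. (inverse (fst w), inverse (snd w), w))"
        using Kt by (intro continuous_intros) (auto simp: torus2_def)
      then have "bounded ((\<lambda>w. (inverse (fst w), inverse (snd w), w)) ` K)"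
        using K(2) compact_continuous_image compact_imp_bounded by blast
      then obtain M where M: "\<And>w. w \<in> K \<Longrightarrow> norm (inverse (fst w), inverse (snd w), w) \<le> M"
        unfolding bounded_iff by auto
      have "norm (inverse (fst w)) \<le> M \<and> norm (inverse (snd w)) \<le> M \<and> norm (fst w) \<le> M \<and> norm (snd w) \<le> M"
        if "w \<in> K" for w
        using M[OF that] norm_fst_le[of "inverse (fst w)" "(inverse (snd w), w)"]
          norm_snd_le[of "(inverse (snd w), w)" "inverse (fst w)"]
          norm_fst_le[of "inverse (snd w)" w] norm_snd_le[of w "inverse (snd w)"]
          norm_fst_le[of "fst w" "snd w"] norm_snd_le[of "snd w" "fst w"] by simp
      then show ?thesis by blast
    qed
    then obtain M0 where M0: "\<And>w. w \<in> K \<Longrightarrow> norm (inverse (fst w)) \<le> M0 \<and> norm (inverse (snd w)) \<le> M0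
        \<and> norm (fst w) \<le> M0 \<and> norm (snd w) \<le> M0" by blast
    \<comment> \<open>The maximum makes the bound positive even if \<open>K\<close> is
      empty.\<close>
    define M where "M = max M0 1"
    have M: "norm (inverse (fst w)) \<le> M" "norm (inverse (snd w)) \<le> M" "norm (fst w) \<le> M" "norm (snd w) \<le> M"
      if "w \<in> K" for w using M0[OF that] by (auto simp: M_def)
    have M1: "M \<ge> 1" by (simp add: M_def)
    define N where "N = {P. 1 + fst P + snd P = 0 \<and> 1 / (6 * M) \<le> cmod (fst P) \<and> cmod (fst P) \<le> 6 * M
        \<and> 1 / (6 * M) \<le> cmod (snd P) \<and> cmod (snd P) \<le> 6 * M}"
    have NH: "N \<subseteq> H"
    proof
      fix P assume P: "P \<in> N"
      have "1 / (6 * M) > 0" using M1 by simp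
      then have "cmod (fst P) > 0" "cmod (snd P) > 0" using P by (auto simp: N_def)
      then show "P \<in> H" using P by (cases P) (auto simp: H_def torus2_def N_def)
    qed
    have pb: "1/6 \<le> x powr t \<and> x powr t \<le> 6" if "1/6 \<le> x" "x \<le> 6" for x :: real
    proof -
      have "x powr t \<le> 6 powr t" using that t by (intro powr_mono2) auto
      also have "6 powr t \<le> 6 powr 1" using t by (intro powr_mono) auto
      finally have 1: "x powr t \<le> 6" by simp
      have "(1/6) powr 1 \<le> (1/6 :: real) powr t" using t by (intro powr_mono') auto
      also have "(1/6) powr t \<le> x powr t" using that t by (intro powr_mono2) auto
      finally show ?thesis using 1 by simp
    qed
    have bd: "1 / (6 * M) \<le> x \<and> x \<le> 6 * M"
      if "x > 0" "w = x * q" "1/6 \<le> q" "q \<le> 6" "inverse w \<le> M" "w \<le> M" for x w q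
    proof
      have w: "w > 0" using that by auto
      have "x * (1/6) \<le> w" unfolding that(2) using that by (intro mult_left_mono) auto
      then show "x \<le> 6 * M" using that(6) by linarith
      have "1 / M \<le> w" using that w M1 by (simp add: field_simps)
      also have "w \<le> x * 6" unfolding that(2) using that by (intro mult_left_mono) auto
      finally show "1 / (6 * M) \<le> x" using M1 by (simp add: field_simps)
    qed
    have "H \<inter> ?f -` K \<subseteq> N"
    proof
      fix P assume P: "P \<in> H \<inter> ?f -` K"
      then have PH: "P \<in> H" and w: "isotopy (P, t) \<in> K" by auto
      note b = ratio_bounds[OF PH] and c = isotopy_cmod[OF PH t]
      have "1 / (6 * M) \<le> cmod (fst P) \<and> cmod (fst P) \<le> 6 * M"
        using pb[OF b(1,2)] M[OF w] by (intro bd[OF cmod_pos(1)[OF PH] c(1)]) (auto simp: norm_inverse)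
      moreover have "1 / (6 * M) \<le> cmod (snd P) \<and> cmod (snd P) \<le> 6 * M"
        using pb[OF b(3,4)] M[OF w] by (intro bd[OF cmod_pos(2)[OF PH] c(2)]) (auto simp: norm_inverse)
      ultimately show "P \<in> N" using PH by (auto simp: N_def H_def)
    qed
    then have "H \<inter> ?f -` K = N \<inter> ?f -` K" using NH by auto
    moreover have "compact N" unfolding N_def by (rule H_sublevel_compact)
    moreover have "closedin (top_of_set N) (N \<inter> ?f -` K)"
      using continuous_on_subset[OF cont NH] compact_imp_closed[OF K(2)]
      by (rule continuous_closedin_preimage)
    ultimately show ?thesis by (metis closedin_compact)
  qed
  show ?thesis
  proof (rule homeomorphism_injective_closed_map[OF cont refl inj])
    fix U assume "closedin (top_of_set H) U"
    then show "closedin (top_of_set (?f ` H)) (?f ` U)"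
      by (rule proper_map) (use proper in auto)
  qed blast
qed

section \<open>The phase tropical line\<close>

definition tropical_point :: "real \<Rightarrow> real \<Rightarrow> real \<Rightarrow> real \<Rightarrow> real \<Rightarrow> real \<Rightarrow> complex \<times> complex" where
  "tropical_point \<sigma> a b c q r = (of_real (b / a) * fst (phases \<sigma> q r), of_real (c / a) * snd (phases \<sigma> q r))"

text \<open>Here \<open>a\<close>, \<open>b\<close>, \<open>c\<close> are homogeneous moduli scaled
  to maximum 1, and the tropical line is the locus where the maximum is attained at least twice.
  Away from its vertex, \<open>a = b = c = 1\<close>, the angle belonging to the smallest modulus is
  0.\<close>

definition tropical_params :: "real \<Rightarrow> real \<Rightarrow> real \<Rightarrow> real \<Rightarrow> real \<Rightarrow> real \<Rightarrow> bool" where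
  "tropical_params a b c p q r \<longleftrightarrow>
     p \<ge> 0 \<and> q \<ge> 0 \<and> r \<ge> 0 \<and> p + q + r = 1 \<and> 0 < a \<and> 0 < b \<and> 0 < c \<and>
     (a = 1 \<and> b = 1 \<and> c \<le> 1 \<and> (c < 1 \<longrightarrow> r = 0) \<or>
      a = 1 \<and> c = 1 \<and> b \<le> 1 \<and> (b < 1 \<longrightarrow> q = 0) \<or>
      b = 1 \<and> c = 1 \<and> a \<le> 1 \<and> (a < 1 \<longrightarrow> p = 0))"

lemma isotopy_one:
  assumes "P \<in> H" "\<sigma> = 1 \<or> \<sigma> = - 1" "\<sigma> * Im (fst P) \<ge> 0"
  shows "isotopy (P, 1) = tropical_point \<sigma> (modulus0 P) (modulus1 P) (modulus2 P) (bary1 P) (bary2 P)"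
proof -
  have "cmod (fst P) * ratio1 P = modulus1 P / modulus0 P" "cmod (snd P) * ratio2 P = modulus2 P / modulus0 P"
    using cmod_pos[OF assms(1)] by (simp_all add: ratio1_def ratio2_def)
  then show ?thesis
    using ratio_pos[OF assms(1)]
    by (simp add: isotopy_def mix_phase_def tropical_point_def limit_phase_eq[OF assms]
        sgn_div_norm phases_norm del: of_real_mult of_real_divide)
qed

lemma H_sign: obtains \<sigma> :: real where "\<sigma> = 1 \<or> \<sigma> = - 1" "\<sigma> * Im (fst P) \<ge> 0"
  by (cases "Im (fst P) \<ge> 0") (force intro: that[of 1], force intro: that[of "- 1"])

lemma H_tropical_params:
  assumes "P \<in> H"
  shows "tropical_params (modulus0 P) (modulus1 P) (modulus2 P) (bary0 P) (bary1 P) (bary2 P)"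
proof -
  note D = H_disc_coords[OF assms] and b = sides_bounds[OF assms]
  have le: "modulus0 P \<le> 1" "modulus1 P \<le> 1" "modulus2 P \<le> 1" by (simp_all add: modulus0_def modulus1_def modulus2_def leg_modulus_le_one)
  have "modulus0 P = 1 \<and> modulus1 P = 1 \<and> (modulus2 P < 1 \<longrightarrow> bary2 P = 0) \<or>
      modulus0 P = 1 \<and> modulus2 P = 1 \<and> (modulus1 P < 1 \<longrightarrow> bary1 P = 0) \<or>
      modulus1 P = 1 \<and> modulus2 P = 1 \<and> (modulus0 P < 1 \<longrightarrow> bary0 P = 0)"
    using D
  proof (cases rule: disc_coords_cases)
    case central
    then show ?thesis using b by (simp add: modulus0_def modulus1_def modulus2_def leg_modulus_eq_one)
  next
    case leg_a
    note D' = disc_coords_swap(3)[OF disc_coords_swap(3)[OF D]]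
    show ?thesis
      using bary_leg(3)[OF D' leg_a] disc_coords_legs_disjoint[OF D' leg_a] b
      by (simp add: modulus1_def modulus2_def bary0_def leg_modulus_eq_one)
  next
    case leg_b
    note D' = disc_coords_swap(2)[OF D]
    show ?thesis
      using bary_leg(3)[OF D' leg_b] disc_coords_legs_disjoint[OF D' leg_b] b
      by (simp add: modulus0_def modulus2_def bary1_def leg_modulus_eq_one)
  next
    case leg_c
    show ?thesis
      using bary_leg(3)[OF D leg_c] disc_coords_legs_disjoint[OF D leg_c] b
      by (simp add: modulus0_def modulus1_def bary2_def leg_modulus_eq_one)
  qed
  then show ?thesis
    unfolding tropical_params_def
    using barys_nonneg[OF assms] barys_sum[of P] modulus_pos[OF assms] le by blast
qed

lemma tropical_params_realize:
  assumes "tropical_params a b c p q r" "\<sigma> = 1 \<or> \<sigma> = - 1"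
  shows "\<exists>P\<in>H. \<sigma> * Im (fst P) \<ge> 0 \<and> modulus0 P = a \<and> modulus1 P = b \<and> modulus2 P = c \<and> bary1 P = q \<and> bary2 P = r"
proof -
  have nonneg: "p \<ge> 0" "q \<ge> 0" "r \<ge> 0" "p + q + r = 1" "0 < a" "0 < b" "0 < c"
    using assms(1) by (auto simp: tropical_params_def)
  have "\<exists>x y z. disc_coords x y z \<and> leg_modulus x = a \<and> leg_modulus y = b \<and> leg_modulus z = c \<and>
      bary y x z = q \<and> bary z x y = r"
  proof -
    consider "a = 1" "b = 1" "c \<le> 1" "c < 1 \<longrightarrow> r = 0" | "a = 1" "c = 1" "b \<le> 1" "b < 1 \<longrightarrow> q = 0"
      | "b = 1" "c = 1" "a \<le> 1" "a < 1 \<longrightarrow> p = 0"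
      using assms(1) unfolding tropical_params_def by blast
    then show ?thesis
    proof cases
      case 1
      then show ?thesis using disc_coords_realize[of p q r c] nonneg by blast
    next
      case 2
      \<comment> \<open>\<open>disc_coords_realize\<close> expects the small modulus in the last
        place, so the other two legs use permuted coordinates.\<close>
      then obtain x z y where "disc_coords x z y" "leg_modulus x = 1" "leg_modulus z = 1" "leg_modulus y = b"
        "bary z x y = r" "bary y x z = q"
        using disc_coords_realize[of p r q b] nonneg by force
      then show ?thesis using 2 disc_coords_swap(2) by blast
    next
      case 3
      then obtain y z x where "disc_coords y z x" "leg_modulus y = 1" "leg_modulus z = 1" "leg_modulus x = a"
        "bary y z x = q" "bary z y x = r"
        using disc_coords_realize[of q r p a] nonneg by force
      then show ?thesis using 3 disc_coords_swap(3) bary_swap by metis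
    qed
  qed
  then obtain x y z where xyz: "disc_coords x y z" "leg_modulus x = a" "leg_modulus y = b" "leg_modulus z = c"
      "bary y x z = q" "bary z x y = r" by blast
  obtain P where "P \<in> H" "side0 P = x" "side1 P = y" "side2 P = z" "\<sigma> * Im (fst P) \<ge> 0"
    using H_realize[OF xyz(1) assms(2)] by blast
  then show ?thesis
    using xyz by (intro bexI[of _ P]) (auto simp: modulus0_def modulus1_def modulus2_def bary1_def bary2_def)
qed

definition tropical_model :: "(complex \<times> complex) set" where
  "tropical_model = {w. \<exists>\<sigma> a b c p q r. (\<sigma> = 1 \<or> \<sigma> = - 1) \<and> tropical_params a b c p q r \<and>
      w = tropical_point \<sigma> a b c q r}"

lemma isotopy_one_image: "(\<lambda>P. isotopy (P, 1)) ` H = tropical_model"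
proof (intro set_eqI iffI)
  fix w assume "w \<in> (\<lambda>P. isotopy (P, 1)) ` H"
  then obtain P where P: "P \<in> H" "w = isotopy (P, 1)" by auto
  obtain \<sigma> :: real where \<sigma>: "\<sigma> = 1 \<or> \<sigma> = - 1" "\<sigma> * Im (fst P) \<ge> 0" by (rule H_sign)
  show "w \<in> tropical_model"
    unfolding tropical_model_def
    using isotopy_one[OF P(1) \<sigma>] H_tropical_params[OF P(1)] \<sigma>(1) P(2) by blast
next
  fix w assume "w \<in> tropical_model"
  then obtain \<sigma> a b c p q r where *: "\<sigma> = 1 \<or> \<sigma> = - 1" "tropical_params a b c p q r"
      "w = tropical_point \<sigma> a b c q r"
    unfolding tropical_model_def by blast
  then show "w \<in> (\<lambda>P. isotopy (P, 1)) ` H"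
    using tropical_params_realize[OF *(2,1)] isotopy_one[OF _ *(1)] by force
qed

lemma tropical_point_norm:
  assumes "a > 0" "b > 0" "c > 0"
  shows "cmod (fst (tropical_point \<sigma> a b c q r)) = b / a" "cmod (snd (tropical_point \<sigma> a b c q r)) = c / a"
  using assms by (simp_all add: tropical_point_def norm_mult phases_norm norm_divide)

text \<open>Homogeneous coordinates are unique once their maximum is 1: a factor \<open>l\<close>
  above 1 would push a coordinate beyond 1, a factor below 1 would leave none equal to 1.\<close>

lemma tropical_params_scale:
  assumes "tropical_params a b c p q r" "tropical_params a' b' c' p' q' r'"
    and "b / a = b' / a'" "c / a = c' / a'"
  shows "a = a' \<and> b = b' \<and> c = c'"
proof -
  have pos: "a > 0" "a' > 0" using assms by (auto simp: tropical_params_def)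
  define l where "l = a' / a"
  have l: "a' = l * a" "b' = l * b" "c' = l * c"
    using pos assms(3,4) by (auto simp: l_def field_simps)
  have "l > 0" using pos by (simp add: l_def)
  have m: "a = 1 \<or> b = 1 \<or> c = 1" "a' = 1 \<or> b' = 1 \<or> c' = 1"
    "a \<le> 1" "b \<le> 1" "c \<le> 1" "a' \<le> 1" "b' \<le> 1" "c' \<le> 1"
    using assms(1,2) by (auto simp: tropical_params_def)
  have "l \<le> 1" using m l by auto
  moreover have "l \<ge> 1"
  proof (rule ccontr)
    assume "\<not> l \<ge> 1"
    then have "l * x < 1" if "x \<le> 1" for x
      using mult_left_mono[OF that, of l] \<open>l > 0\<close> \<open>\<not> l \<ge> 1\<close> by linarith
    then show False using m l by (metis less_irrefl)
  qed
  ultimately show ?thesis using l by simp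
qed

lemma cos_sign: "\<sigma> = 1 \<or> \<sigma> = - 1 \<Longrightarrow> cos (\<sigma> * pi * x) = cos (pi * x)"
  by auto

text \<open>Norms recover the moduli and cosines the angles, whatever the orientation; together they
  determine the sides. The orientation is visible in the phases unless the triangle is
  degenerate.\<close>

lemma isotopy_one_inj: "inj_on (\<lambda>P. isotopy (P, 1)) H"
proof (rule inj_onI)
  fix P Q assume P: "P \<in> H" and Q: "Q \<in> H" and eq: "isotopy (P, 1) = isotopy (Q, 1)"
  obtain \<sigma> :: real where \<sigma>: "\<sigma> = 1 \<or> \<sigma> = - 1" "\<sigma> * Im (fst P) \<ge> 0" by (rule H_sign)
  obtain \<tau> :: real where \<tau>: "\<tau> = 1 \<or> \<tau> = - 1" "\<tau> * Im (fst Q) \<ge> 0" by (rule H_sign)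
  have e: "tropical_point \<sigma> (modulus0 P) (modulus1 P) (modulus2 P) (bary1 P) (bary2 P)
      = tropical_point \<tau> (modulus0 Q) (modulus1 Q) (modulus2 Q) (bary1 Q) (bary2 Q)"
    using isotopy_one[OF P \<sigma>] isotopy_one[OF Q \<tau>] eq by simp
  have m: "modulus0 P = modulus0 Q" "modulus1 P = modulus1 Q" "modulus2 P = modulus2 Q"
    using tropical_params_scale[OF H_tropical_params[OF P] H_tropical_params[OF Q]]
      tropical_point_norm[OF modulus_pos[OF P]] tropical_point_norm[OF modulus_pos[OF Q]] e by metis+
  have ph: "phases \<sigma> (bary1 P) (bary2 P) = phases \<tau> (bary1 Q) (bary2 Q)"
    using e m modulus_pos[OF Q] by (simp add: tropical_point_def prod_eq_iff)
  have cosinj: "x = y" if "0 \<le> x" "x \<le> 1" "0 \<le> y" "y \<le> 1" "cos (pi * x) = cos (pi * y)" for x y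
    using cos_inj_pi[of "pi * x" "pi * y"] that by (auto simp: mult_left_le)
  have "cos (pi * bary1 P) = cos (pi * bary1 Q)" "cos (pi * bary2 P) = cos (pi * bary2 Q)"
    using ph cos_sign[OF \<sigma>(1)] cos_sign[OF \<tau>(1)] by (auto simp: phases_def complex_eq_iff)
  then have b: "bary1 P = bary1 Q" "bary2 P = bary2 Q"
    using barys_nonneg[OF P] barys_nonneg[OF Q] barys_le_one[OF P] barys_le_one[OF Q]
    by (auto intro: cosinj)
  then have "bary0 P = bary0 Q" using barys_sum[of P] barys_sum[of Q] by simp
  then have u: "side0 P = side0 Q" "side1 P = side1 Q" "side2 P = side2 Q"
    using disc_coords_determined[OF H_disc_coords[OF P] H_disc_coords[OF Q]] m b
    by (auto simp: modulus0_def modulus1_def modulus2_def bary0_def bary1_def bary2_def)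
  show "P = Q"
  proof (rule H_eqI[OF P Q sides_determine_moduli[OF u]], rule ccontr)
    \<comment> \<open>With equal angles, opposite orientations give equal phases only if the sines
      vanish. The angles then form a vertex, so \<open>P\<close> would be real.\<close>
    assume neg: "\<not> Im (fst P) * Im (fst Q) \<ge> 0"
    then have "\<tau> = - \<sigma>" and nz: "Im (fst P) \<noteq> 0"
      using \<sigma> \<tau> by (auto simp: mult_nonneg_nonneg mult_nonpos_nonpos)
    then have "sin (pi * bary1 P) = 0" "sin (pi * bary2 P) = 0"
      using ph b \<sigma>(1) by (auto simp: phases_def complex_eq_iff)
    moreover have int: "x = 0 \<or> x = 1" if "sin (pi * x) = 0" "0 \<le> x" "x \<le> 1" for x
      using sin_gt_zero[of "pi * x"] that by (cases "x = 0 \<or> x = 1") auto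
    ultimately have "bary1 P = 0 \<or> bary1 P = 1" "bary2 P = 0 \<or> bary2 P = 1"
      using barys_nonneg[OF P] barys_le_one[OF P] by blast+
    then have "bary0 P = 1 \<or> bary1 P = 1 \<or> bary2 P = 1"
      using barys_sum[of P] by auto
    then have "Im (fst P) = 0"
      using bary_vertex_iff[OF H_disc_coords[OF P]] H_real_iff[OF P]
      by (simp add: bary0_def bary1_def bary2_def)
    with nz show False by simp
  qed
qed

section \<open>Explicit legs and coamoeba triangles\<close>

definition leg0 :: "(complex \<times> complex) set" where "leg0 = {(w, - w) |w. cmod w \<ge> 1}"
definition leg1 :: "(complex \<times> complex) set" where "leg1 = {(w, - 1) |w. w \<noteq> 0 \<and> cmod w \<le> 1}"
definition leg2 :: "(complex \<times> complex) set" where "leg2 = {(- 1, w) |w. w \<noteq> 0 \<and> cmod w \<le> 1}"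

text \<open>For each sign, one of the two closed triangles whose union is the closed coamoeba of the
  line, in terms of angles divided by pi.\<close>

definition closed_coamoeba :: "real \<Rightarrow> (complex \<times> complex) set" where
  "closed_coamoeba \<sigma> = {phases \<sigma> q r |q r. q \<ge> 0 \<and> r \<ge> 0 \<and> q + r \<le> 1}"

lemma cis_sign_pi: "\<sigma> = 1 \<or> \<sigma> = - 1 \<Longrightarrow> cis (\<sigma> * pi) = - 1"
  by (auto simp: cis_minus_pi)

text \<open>The angle opposite to the first side is 0, so the other two sides point in opposite
  directions.\<close>

lemma phases_antipodal:
  assumes "\<sigma> = 1 \<or> \<sigma> = - 1" "q + r = 1"
  shows "snd (phases \<sigma> q r) = - fst (phases \<sigma> q r)"
proof -
  have q: "q = 1 - r" using assms(2) by simp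
  have "cis (\<sigma> * pi * q) = cis (\<sigma> * pi) * cis (- (\<sigma> * pi * r))"
    unfolding q cis_mult by (simp add: algebra_simps)
  then show ?thesis using cis_sign_pi[OF assms(1)] by (simp add: phases_def)
qed

text \<open>The argument of \<open>- w\<close> is split into sign and absolute value, the form in
  which \<open>phases\<close> takes its angles.\<close>

lemma polar_sign:
  fixes w :: complex
  obtains \<sigma> q where "\<sigma> = 1 \<or> \<sigma> = - 1" "0 \<le> q" "q \<le> 1" "w = of_real (cmod w) * - cis (\<sigma> * pi * q)"
proof -
  have "of_real (cmod (- w)) * cis (Arg (- w)) = - w"
    using rcis_cmod_Arg[of "- w"] by (simp only: rcis_def)
  then have w: "w = of_real (cmod w) * - cis (Arg (- w))"
    by (metis minus_minus mult_minus_right norm_minus_cancel)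
  define \<sigma> :: real where "\<sigma> = (if Arg (- w) \<ge> 0 then 1 else - 1)"
  have "\<sigma> * pi * (\<bar>Arg (- w)\<bar> / pi) = Arg (- w)" by (simp add: \<sigma>_def)
  then show ?thesis
    using Arg_bounded[of "- w"] w by (intro that[of \<sigma> "\<bar>Arg (- w)\<bar> / pi"]) (auto simp: \<sigma>_def)
qed

lemma tropical_modelI:
  "\<sigma> = 1 \<or> \<sigma> = - 1 \<Longrightarrow> tropical_params a b c p q r \<Longrightarrow> tropical_point \<sigma> a b c q r \<in> tropical_model"
  unfolding tropical_model_def by blast

text \<open>Replaces parameters by explicit conditions, from which closedness and the comparison
  with valuations can be read off.\<close>

lemma tropical_model_eq:
  "tropical_model = leg0 \<union> leg1 \<union> leg2 \<union> closed_coamoeba 1 \<union> closed_coamoeba (- 1)"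
proof (intro set_eqI iffI)
  fix w assume "w \<in> tropical_model"
  then obtain \<sigma> a b c p q r where \<sigma>: "\<sigma> = 1 \<or> \<sigma> = - 1" and t: "tropical_params a b c p q r"
      and w: "w = tropical_point \<sigma> a b c q r"
    unfolding tropical_model_def by blast
  have nz: "fst (phases \<sigma> q r) \<noteq> 0" "snd (phases \<sigma> q r) \<noteq> 0"
    using phases_norm[of \<sigma> q r] by force+
  consider "a = 1" "b = 1" "c = 1" | "a = 1" "b = 1" "c < 1" "r = 0" | "a = 1" "c = 1" "b < 1" "q = 0"
    | "b = 1" "c = 1" "a < 1" "p = 0"
    using t unfolding tropical_params_def by force
  then show "w \<in> leg0 \<union> leg1 \<union> leg2 \<union> closed_coamoeba 1 \<union> closed_coamoeba (- 1)"
  proof cases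
    case 1
    then have "w = phases \<sigma> q r" by (simp add: w tropical_point_def)
    then have "w \<in> closed_coamoeba \<sigma>"
      using t unfolding closed_coamoeba_def tropical_params_def by force
    then show ?thesis using \<sigma> by auto
  next
    case 2
    then have "w = (- 1, of_real c * snd (phases \<sigma> q r))" by (simp add: w tropical_point_def phases_def)
    then have "w \<in> leg2"
      using 2 t nz by (auto simp: leg2_def norm_mult phases_norm tropical_params_def)
    then show ?thesis by simp
  next
    case 3
    then have "w = (of_real b * fst (phases \<sigma> q r), - 1)" by (simp add: w tropical_point_def phases_def)
    then have "w \<in> leg1"
      using 3 t nz by (auto simp: leg1_def norm_mult phases_norm tropical_params_def)
    then show ?thesis by simp
  next
    case 4
    have "q + r = 1" "a > 0" using t 4 by (auto simp: tropical_params_def)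
    then have "w = (of_real (1 / a) * fst (phases \<sigma> q r), - (of_real (1 / a) * fst (phases \<sigma> q r)))"
      using 4 phases_antipodal[OF \<sigma>, of q r] by (simp add: w tropical_point_def)
    moreover have "cmod (of_real (1 / a) * fst (phases \<sigma> q r)) \<ge> 1"
      using 4 \<open>a > 0\<close> by (simp add: norm_mult norm_divide phases_norm)
    ultimately have "w \<in> leg0" unfolding leg0_def by blast
    then show ?thesis by simp
  qed
next
  fix v assume "v \<in> leg0 \<union> leg1 \<union> leg2 \<union> closed_coamoeba 1 \<union> closed_coamoeba (- 1)"
  then consider "v \<in> leg0" | "v \<in> leg1" | "v \<in> leg2"
    | \<sigma> where "\<sigma> = 1 \<or> \<sigma> = - 1" "v \<in> closed_coamoeba \<sigma>" by blast
  then show "v \<in> tropical_model"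
  proof cases
    case 1
    then obtain w where w: "v = (w, - w)" "cmod w \<ge> 1" by (auto simp: leg0_def)
    obtain \<tau> r where p: "\<tau> = 1 \<or> \<tau> = - 1" "0 \<le> r" "r \<le> 1" "w = of_real (cmod w) * - cis (\<tau> * pi * r)"
      by (rule polar_sign)
    \<comment> \<open>The first component of \<open>phases\<close> carries its angle with a minus
      sign, so a polar form of the first coordinate is matched by the opposite orientation.\<close>
    have s: "- \<tau> = 1 \<or> - \<tau> = - 1" using p by auto
    have "fst (phases (- \<tau>) (1 - r) r) = - cis (\<tau> * pi * r)" by (simp add: phases_def)
    then have "tropical_point (- \<tau>) (1 / cmod w) 1 1 (1 - r) r = (w, - w)"
      using phases_antipodal[OF s, of "1 - r" r] p(4)[symmetric] by (simp add: tropical_point_def minus_equation_iff)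
    moreover have "tropical_params (1 / cmod w) 1 1 0 (1 - r) r"
      using p w by (auto simp: tropical_params_def divide_simps)
    ultimately show ?thesis using tropical_modelI[OF s] w by metis
  next
    case 2
    then obtain w where w: "v = (w, - 1)" "w \<noteq> 0" "cmod w \<le> 1" by (auto simp: leg1_def)
    obtain \<tau> r where p: "\<tau> = 1 \<or> \<tau> = - 1" "0 \<le> r" "r \<le> 1" "w = of_real (cmod w) * - cis (\<tau> * pi * r)"
      by (rule polar_sign)
    have s: "- \<tau> = 1 \<or> - \<tau> = - 1" using p by auto
    have "tropical_point (- \<tau>) 1 (cmod w) 1 0 r = (w, - 1)"
      using p(4) by (simp add: tropical_point_def phases_def)
    moreover have "tropical_params 1 (cmod w) 1 (1 - r) 0 r"
      using p w by (auto simp: tropical_params_def)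
    ultimately show ?thesis using tropical_modelI[OF s] w by metis
  next
    case 3
    then obtain w where w: "v = (- 1, w)" "w \<noteq> 0" "cmod w \<le> 1" by (auto simp: leg2_def)
    obtain \<tau> q where p: "\<tau> = 1 \<or> \<tau> = - 1" "0 \<le> q" "q \<le> 1" "w = of_real (cmod w) * - cis (\<tau> * pi * q)"
      by (rule polar_sign)
    have "tropical_point \<tau> 1 1 (cmod w) q 0 = (- 1, w)"
      using p(4) by (simp add: tropical_point_def phases_def)
    moreover have "tropical_params 1 1 (cmod w) (1 - q) q 0"
      using p w by (auto simp: tropical_params_def)
    ultimately show ?thesis using tropical_modelI[OF p(1)] w by metis
  next
    case 4
    then obtain q r where "v = phases \<sigma> q r" "q \<ge> 0" "r \<ge> 0" "q + r \<le> 1"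
      by (auto simp: closed_coamoeba_def)
    then have "v = tropical_point \<sigma> 1 1 1 q r" "tropical_params 1 1 1 (1 - q - r) q r"
      by (auto simp: tropical_point_def tropical_params_def)
    then show ?thesis using tropical_modelI[OF 4(1)] by metis
  qed
qed

lemma closed_coamoeba_closed: "closed (closed_coamoeba \<sigma>)"
proof -
  define D where "D = {x :: real \<times> real. fst x \<ge> 0 \<and> snd x \<ge> 0 \<and> fst x + snd x \<le> 1}"
  have "closed D"
    unfolding D_def by (intro closed_Collect_conj closed_Collect_le continuous_intros)
  moreover have "D \<subseteq> {0..1} \<times> {0..1}" by (auto simp: D_def)
  then have "bounded D" by (rule bounded_subset[rotated]) (intro bounded_Times bounded_closed_interval)
  ultimately have "compact D" by (simp add: compact_eq_bounded_closed)
  moreover have "continuous_on D (\<lambda>x. phases \<sigma> (fst x) (snd x))"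
    unfolding phases_def cis_conv_exp by (intro continuous_intros)
  ultimately have "compact ((\<lambda>x. phases \<sigma> (fst x) (snd x)) ` D)"
    using compact_continuous_image by blast
  moreover have "(\<lambda>x. phases \<sigma> (fst x) (snd x)) ` D = closed_coamoeba \<sigma>"
  proof (intro set_eqI iffI)
    fix v assume "v \<in> closed_coamoeba \<sigma>"
    then obtain q r where "v = phases \<sigma> q r" "(q, r) \<in> D"
      by (auto simp: D_def closed_coamoeba_def)
    then show "v \<in> (\<lambda>x. phases \<sigma> (fst x) (snd x)) ` D" by force
  qed (auto simp: D_def closed_coamoeba_def)
  ultimately show ?thesis using compact_imp_closed by metis
qed

text \<open>\<open>leg1\<close> and \<open>leg2\<close> run into the coordinate axes, so closedness
  is relative to the torus, in which closed conditions cut out the legs.\<close>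

lemma tropical_model_closedin: "closedin (top_of_set torus2) tropical_model"
proof -
  have "leg0 = torus2 \<inter> {x. snd x = - fst x \<and> cmod (fst x) \<ge> 1}"
    by (auto simp: leg0_def torus2_def)
  moreover have "closed {x :: complex \<times> complex. snd x = - fst x \<and> cmod (fst x) \<ge> 1}"
    by (intro closed_Collect_conj closed_Collect_le closed_Collect_eq continuous_intros)
  ultimately have 0: "closedin (top_of_set torus2) leg0" by (metis closedin_closed_Int)
  have "leg1 = torus2 \<inter> {x. snd x = - 1 \<and> cmod (fst x) \<le> 1}"
    by (auto simp: leg1_def torus2_def)
  moreover have "closed {x :: complex \<times> complex. snd x = - 1 \<and> cmod (fst x) \<le> 1}"
    by (intro closed_Collect_conj closed_Collect_le closed_Collect_eq continuous_intros)
  ultimately have 1: "closedin (top_of_set torus2) leg1" by (metis closedin_closed_Int)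
  have "leg2 = torus2 \<inter> {x. fst x = - 1 \<and> cmod (snd x) \<le> 1}"
    by (auto simp: leg2_def torus2_def)
  moreover have "closed {x :: complex \<times> complex. fst x = - 1 \<and> cmod (snd x) \<le> 1}"
    by (intro closed_Collect_conj closed_Collect_le closed_Collect_eq continuous_intros)
  ultimately have 2: "closedin (top_of_set torus2) leg2" by (metis closedin_closed_Int)
  have "closed_coamoeba \<sigma> \<subseteq> torus2" for \<sigma>
    by (auto simp: closed_coamoeba_def torus2_def phases_def)
  then have "closedin (top_of_set torus2) (closed_coamoeba \<sigma>)" for \<sigma>
    by (intro closed_subset closed_coamoeba_closed)
  with 0 1 2 show ?thesis unfolding tropical_model_eq by (intro closedin_Un)
qed

section \<open>Valuations of solutions lie in the model\<close>

lemma val_C_leading: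
  assumes "coeff z j \<noteq> 0" "\<And>i. i < j \<Longrightarrow> coeff z i = 0"
  shows "val_C z = of_real (exp (- j)) * sgn (coeff z j)"
proof -
  have "z \<noteq> 0" using assms(1) by (auto simp: zero_puiseux.rep_eq)
  then have "lowest_exponent z = j"
    using coeff_lowest_exponent[of z] assms by (metis linorder_not_less order_antisym_conv)
  then have "val_C z = exp (of_real (- j)) * exp (\<i> * of_real (Arg (coeff z j)))"
    by (simp add: val_C_def exp_add[symmetric])
  then show ?thesis
    using cis_Arg[OF assms(1)] by (simp add: cis_conv_exp[symmetric] exp_of_real[symmetric])
qed

lemma val_C_lowest:
  assumes "z \<noteq> 0"
  shows "val_C z = of_real (exp (- lowest_exponent z)) * sgn (coeff z (lowest_exponent z))"
  using coeff_lowest_exponent[OF assms] by (intro val_C_leading) (auto simp: not_less[symmetric])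

lemma Z_f_coeff:
  assumes "1 + z1 + z2 = 0"
  shows "(if j = 0 then 1 else 0) + coeff z1 j + coeff z2 j = 0"
  using arg_cong[OF assms, of "\<lambda>z. coeff z j"]
  by (simp add: plus_puiseux.rep_eq one_puiseux.rep_eq zero_puiseux.rep_eq)

lemma sgn_uminus_one: "sgn (- 1 :: complex) = - 1"
  by (simp add: sgn_eq)

lemma coamoeba_upper:
  assumes P: "P \<in> H" and im: "Im (fst P) > 0"
  shows "\<exists>q r. (sgn (fst P), sgn (snd P)) = phases 1 q r \<and> q \<ge> 0 \<and> r \<ge> 0 \<and> q + r \<le> 1"
proof -
  define \<alpha> \<beta> where "\<alpha> = Arg (fst P)" "\<beta> = Arg (snd P)"
  have nz: "fst P \<noteq> 0" "snd P \<noteq> 0" using P H_iff by blast+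
  have \<alpha>: "0 < \<alpha>" "\<alpha> < pi" using im Arg_lt_pi[of "fst P"] by (auto simp: \<alpha>_\<beta>_def)
  have \<beta>: "- pi < \<beta>" "\<beta> < 0"
    using im H_cartesian(2)[OF P] Arg_neg_iff[of "snd P"] Arg_bounded[of "snd P"] by (auto simp: \<alpha>_\<beta>_def)
  \<comment> \<open>The excess over pi is the third angle. Were it negative, the sine below would be
    positive, whereas \<open>snd P = - 1 - fst P\<close> makes the corresponding cross product equal
    to \<open>- Im (fst P)\<close>.\<close>
  have "\<alpha> - \<beta> \<ge> pi"
  proof (rule ccontr)
    assume "\<not> \<alpha> - \<beta> \<ge> pi"
    then have "sin (\<alpha> - \<beta>) > 0" using \<alpha> \<beta> by (intro sin_gt_zero) auto
    moreover have "fst P * cnj (snd P) = of_real (cmod (fst P) * cmod (snd P)) * cis (\<alpha> - \<beta>)"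
    proof -
      have "fst P * cnj (snd P) = rcis (cmod (fst P)) \<alpha> * cnj (rcis (cmod (snd P)) \<beta>)"
        by (simp add: \<alpha>_\<beta>_def rcis_cmod_Arg)
      also have "\<dots> = of_real (cmod (fst P) * cmod (snd P)) * (cis \<alpha> * cis (- \<beta>))"
        by (simp add: rcis_def cis_cnj)
      finally show ?thesis by (simp add: cis_mult)
    qed
    then have "Im (fst P * cnj (snd P)) = cmod (fst P) * cmod (snd P) * sin (\<alpha> - \<beta>)" by simp
    moreover have "Im (fst P * cnj (snd P)) = - Im (fst P)"
      by (simp add: H_cartesian(1,2)[OF P]) (simp add: algebra_simps)
    ultimately have "cmod (fst P) * cmod (snd P) * sin (\<alpha> - \<beta>) < 0" using im by simp
    with \<open>sin (\<alpha> - \<beta>) > 0\<close> show False using nz by (simp add: mult_less_0_iff)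
  qed
  then have "(pi + \<beta>) / pi + (pi - \<alpha>) / pi \<le> 1"
    unfolding add_divide_distrib[symmetric] by (simp add: divide_le_eq)
  moreover have "phases 1 ((pi + \<beta>) / pi) ((pi - \<alpha>) / pi) = (sgn (fst P), sgn (snd P))"
  proof -
    have "- cis (\<alpha> - pi) = cis \<alpha>" "- cis (pi + \<beta>) = cis \<beta>" by (simp_all add: complex_eq_iff)
    then show ?thesis
      using cis_Arg[OF nz(1)] cis_Arg[OF nz(2)] by (simp add: phases_def \<alpha>_\<beta>_def)
  qed
  ultimately show ?thesis
    using \<alpha> \<beta> by (intro exI[of _ "(pi + \<beta>) / pi"] exI[of _ "(pi - \<alpha>) / pi"]) simp
qed

lemma phases_cnj:
  "(cnj (fst (phases \<sigma> q r)), cnj (snd (phases \<sigma> q r))) = phases (- \<sigma>) q r"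
  by (simp add: phases_def cis_cnj)

lemma coamoeba_subset:
  assumes P: "P \<in> H"
  shows "(sgn (fst P), sgn (snd P)) \<in> closed_coamoeba 1 \<union> closed_coamoeba (- 1)"
proof -
  consider "Im (fst P) = 0" | "Im (fst P) > 0" | "Im (fst P) < 0" by linarith
  then show ?thesis
  proof cases
    case 1
    then have "(sgn (fst P), sgn (snd P)) = phases 1 (bary1 P) (bary2 P)" using phases_real[OF P] by simp
    then have "(sgn (fst P), sgn (snd P)) \<in> closed_coamoeba 1"
      unfolding closed_coamoeba_def using barys_nonneg[OF P] barys_sum[of P] by force
    then show ?thesis by simp
  next
    case 2
    then have "(sgn (fst P), sgn (snd P)) \<in> closed_coamoeba 1"
      unfolding closed_coamoeba_def using coamoeba_upper[OF P] by blast
    then show ?thesis by simp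
  next
    case 3
    \<comment> \<open>Conjugation leads to the upper half plane and exchanges the two
      triangles.\<close>
    define Q where "Q = (cnj (fst P), cnj (snd P))"
    have "1 + fst Q + snd Q = cnj (1 + fst P + snd P)" by (simp add: Q_def)
    also have "1 + fst P + snd P = 0" using P by (auto simp: H_def)
    finally have "1 + fst Q + snd Q = 0" by simp
    then have "Q \<in> H" using P by (auto simp: H_def torus2_def Q_def)
    then obtain q r where q: "(sgn (fst Q), sgn (snd Q)) = phases 1 q r" "q \<ge> 0" "r \<ge> 0" "q + r \<le> 1"
      using coamoeba_upper[of Q] 3 by (auto simp: Q_def)
    have "cnj (sgn (cnj z)) = sgn z" for z by (simp add: sgn_eq)
    then have "(sgn (fst P), sgn (snd P)) = (cnj (sgn (fst Q)), cnj (sgn (snd Q)))"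
      by (simp add: Q_def)
    also have "\<dots> = phases (- 1) q r" using q(1) phases_cnj[of 1 q r] by (metis fst_conv snd_conv)
    finally show ?thesis using q(2-) unfolding closed_coamoeba_def by blast
  qed
qed

text \<open>Among the exponents 0, \<open>j1\<close>, \<open>j2\<close> the minimum occurs at least
  twice, or the leading terms could not cancel. If it occurs exactly twice, two leading terms are
  opposite and the point is on a leg; if three times, the leading coefficients form a point of
  \<open>H\<close>.\<close>

lemma val2_Z_f_subset: "val2_C ` Z_f \<subseteq> tropical_model"
proof
  fix w assume "w \<in> val2_C ` Z_f"
  then obtain z1 z2 where z: "z1 \<noteq> 0" "z2 \<noteq> 0" "1 + z1 + z2 = 0" and w: "w = (val_C z1, val_C z2)"
    by (auto simp: Z_f_def val2_C_def)
  define j1 j2 where "j1 = lowest_exponent z1" "j2 = lowest_exponent z2"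
  note c = Z_f_coeff[OF z(3)]
  have n: "coeff z1 j1 \<noteq> 0" "coeff z2 j2 \<noteq> 0"
    and le: "\<And>j. coeff z1 j \<noteq> 0 \<Longrightarrow> j1 \<le> j" "\<And>j. coeff z2 j \<noteq> 0 \<Longrightarrow> j2 \<le> j"
    using coeff_lowest_exponent[OF z(1)] coeff_lowest_exponent[OF z(2)] by (auto simp: j1_j2_def)
  have v: "val_C z1 = of_real (exp (- j1)) * sgn (coeff z1 j1)" "val_C z2 = of_real (exp (- j2)) * sgn (coeff z2 j2)"
    using val_C_lowest[OF z(1)] val_C_lowest[OF z(2)] by (auto simp: j1_j2_def)
  have nv: "cmod (val_C z1) = exp (- j1)" "cmod (val_C z2) = exp (- j2)"
    using n by (simp_all add: v norm_mult norm_sgn)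
  then have nzv: "val_C z1 \<noteq> 0" "val_C z2 \<noteq> 0" by (metis exp_not_eq_zero norm_zero)+
  \<comment> \<open>The constant 1 has no term of negative exponent, so there the terms of
    \<open>z1\<close> and \<open>z2\<close> must cancel each other.\<close>
  have neg: "j1 = j2 \<and> coeff z2 j2 = - coeff z1 j1" if "j1 < 0 \<or> j2 < 0"
  proof -
    have "coeff z2 j1 = - coeff z1 j1" if "j1 < 0"
      using c[of j1] that by (simp add: add_eq_0_iff)
    moreover have "coeff z1 j2 = - coeff z2 j2" if "j2 < 0"
      using c[of j2] that by (simp add: eq_neg_iff_add_eq_0)
    ultimately show ?thesis
      using that n le by (smt (verit) neg_equal_0_iff_equal)
  qed
  consider "j1 < 0 \<or> j2 < 0" | "j1 > 0" "j2 \<ge> 0" | "j1 \<ge> 0" "j2 > 0" | "j1 = 0" "j2 = 0" by linarith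
  then show "w \<in> tropical_model"
  proof cases
    case 1
    then have "val_C z2 = - val_C z1" "cmod (val_C z1) \<ge> 1"
      using neg v nv by (auto simp: sgn_minus)
    then have "w \<in> leg0" unfolding leg0_def w by auto
    then show ?thesis by (simp add: tropical_model_eq)
  next
    case 2
    then have "coeff z1 0 = 0" using le(1)[of 0] by force
    then have "coeff z2 0 = - 1" using c[of 0] by (simp add: add_eq_0_iff)
    moreover from this have "j2 = 0" using le(2)[of 0] 2 by simp
    ultimately have "val_C z2 = - 1" using v by (simp add: sgn_uminus_one)
    then have "w \<in> leg1" using 2 nv nzv by (auto simp: leg1_def w)
    then show ?thesis by (simp add: tropical_model_eq)
  next
    case 3
    then have "coeff z2 0 = 0" using le(2)[of 0] by force
    then have "coeff z1 0 = - 1" using c[of 0] by (simp add: add_eq_0_iff)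
    moreover from this have "j1 = 0" using le(1)[of 0] 3 by simp
    ultimately have "val_C z1 = - 1" using v by (simp add: sgn_uminus_one)
    then have "w \<in> leg2" using 3 nv nzv by (auto simp: leg2_def w)
    then show ?thesis by (simp add: tropical_model_eq)
  next
    case 4
    then have "(coeff z1 0, coeff z2 0) \<in> H"
      using n c[of 0] by (simp add: H_def torus2_def)
    from coamoeba_subset[OF this] show ?thesis
      using 4 v by (auto simp: w tropical_model_eq)
  qed
qed

section \<open>Points of the model as limits of valuations\<close>

lift_definition monomial :: "complex \<Rightarrow> real \<Rightarrow> puiseux" is "\<lambda>c j i. if i = j then c else 0"
  by (rule well_ordered_subset[OF well_ordered_singleton]) auto

lemma val_C_monomial:
  assumes "c \<noteq> 0" shows "monomial c j \<noteq> 0" "val_C (monomial c j) = of_real (exp (- j)) * sgn c"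
proof -
  have "coeff (monomial c j) j \<noteq> 0" using assms by (simp add: monomial.rep_eq)
  then show "monomial c j \<noteq> 0" by (auto simp: zero_puiseux.rep_eq)
  show "val_C (monomial c j) = of_real (exp (- j)) * sgn c"
    using val_C_leading[of "monomial c j" j] assms by (simp add: monomial.rep_eq)
qed

lemma coeff_complement: "coeff (- 1 - z) i = (if i = 0 then - 1 else 0) - coeff z i"
  by (simp add: minus_puiseux.rep_eq uminus_puiseux.rep_eq one_puiseux.rep_eq)

lemma val2_Z_fI:
  assumes "z1 \<noteq> 0" "z2 \<noteq> 0" "1 + z1 + z2 = 0"
  shows "(val_C z1, val_C z2) \<in> val2_C ` Z_f"
  using assms by (force simp: Z_f_def val2_C_def)

lemma sum_complement:
  fixes z :: "'a::{ab_group_add, one}"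
  shows "1 + z + (- 1 - z) = 0" "1 + (- 1 - z) + z = 0"
  by (simp_all add: algebra_simps)

text \<open>The monomial with valuation \<open>w\<close> has positive exponent, so
  \<open>- 1 - z\<close> starts with the constant -1.\<close>

lemma leg12_in_image:
  assumes "w \<noteq> 0" "cmod w < 1"
  shows "(- 1, w) \<in> val2_C ` Z_f" "(w, - 1) \<in> val2_C ` Z_f"
proof -
  define j where "j = - ln (cmod w)"
  have j: "j > 0" using assms by (simp add: j_def)
  define z where "z = monomial (sgn w) j"
  have z: "z \<noteq> 0" "val_C z = w"
    using val_C_monomial[of "sgn w" j] assms by (auto simp: z_def j_def sgn_zero_iff cmod_mult_sgn)
  have c: "coeff (- 1 - z) 0 = - 1" "\<And>i. i < 0 \<Longrightarrow> coeff (- 1 - z) i = 0"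
    using j unfolding coeff_complement by (auto simp: z_def monomial.rep_eq)
  then have "- 1 - z \<noteq> 0" by (metis neg_equal_0_iff_equal one_neq_zero zero_puiseux.rep_eq)
  moreover have "val_C (- 1 - z) = - 1"
    using val_C_leading[of "- 1 - z" 0] c by (simp add: sgn_uminus_one)
  ultimately show "(- 1, w) \<in> val2_C ` Z_f" "(w, - 1) \<in> val2_C ` Z_f"
    using val2_Z_fI[of z "- 1 - z"] val2_Z_fI[of "- 1 - z" z] z sum_complement[of z] by metis+
qed

text \<open>Now the exponent is negative, so the monomial also dominates
  \<open>- 1 - z\<close>.\<close>

lemma leg0_in_image:
  assumes "cmod w > 1"
  shows "(w, - w) \<in> val2_C ` Z_f"
proof -
  have w: "w \<noteq> 0" using assms by auto
  define j where "j = - ln (cmod w)"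
  have j: "j < 0" using ln_gt_zero[OF assms] by (simp add: j_def)
  define z where "z = monomial (sgn w) j"
  have z: "z \<noteq> 0" "val_C z = w"
    using val_C_monomial[of "sgn w" j] w by (auto simp: z_def j_def sgn_zero_iff cmod_mult_sgn)
  have c: "coeff (- 1 - z) j = - sgn w" "\<And>i. i < j \<Longrightarrow> coeff (- 1 - z) i = 0"
    using j unfolding coeff_complement by (auto simp: z_def monomial.rep_eq)
  have "sgn w \<noteq> 0" using w by (simp add: sgn_zero_iff)
  then have "- 1 - z \<noteq> 0" using c(1) by (metis neg_equal_0_iff_equal zero_puiseux.rep_eq)
  moreover have "val_C (- 1 - z) = - w"
    using val_C_leading[of "- 1 - z" j] c \<open>sgn w \<noteq> 0\<close> w by (auto simp: j_def sgn_minus cmod_mult_sgn)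
  ultimately show "(w, - w) \<in> val2_C ` Z_f"
    using val2_Z_fI[of z "- 1 - z"] z sum_complement[of z] by metis
qed

text \<open>A point of \<open>H\<close> is read as a pair of constant series, whose valuations are
  the phases.\<close>

lemma coamoeba_in_image:
  assumes "P \<in> H" shows "(sgn (fst P), sgn (snd P)) \<in> val2_C ` Z_f"
proof -
  have nz: "fst P \<noteq> 0" "snd P \<noteq> 0" "1 + fst P + snd P = 0"
    using assms by (auto simp: H_def torus2_def)
  have "1 + monomial (fst P) 0 + monomial (snd P) 0 = 0"
    using nz(3) by transfer (auto simp: fun_eq_iff)
  then show ?thesis
    using val2_Z_fI[of "monomial (fst P) 0" "monomial (snd P) 0"] val_C_monomial[of _ 0] nz by simp
qed

text \<open>The law of sines produces a triangle with prescribed angles.\<close>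

lemma open_coamoeba_in_image:
  assumes \<sigma>: "\<sigma> = 1 \<or> \<sigma> = - 1" and q: "q > 0" "r > 0" "q + r < 1"
  shows "phases \<sigma> q r \<in> val2_C ` Z_f"
proof -
  define A B where "A = pi * q" "B = pi * r"
  have ab: "A > 0" "B > 0" "A + B < pi"
  proof -
    show "A > 0" "B > 0" using q by (auto simp: A_B_def)
    have "pi * (q + r) < pi * 1" using q(3) by (intro mult_strict_left_mono) auto
    then show "A + B < pi" by (simp add: A_B_def algebra_simps)
  qed
  have s: "sin A > 0" "sin B > 0" "sin (A + B) > 0" using ab by (auto intro!: sin_gt_zero)
  have ph: "phases \<sigma> q r = (Complex (- cos B) (\<sigma> * sin B), Complex (- cos A) (- \<sigma> * sin A))"
    using \<sigma> by (auto simp: phases_def A_B_def complex_eq_iff)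
  define x y where "x = sin A / sin (A + B)" "y = sin B / sin (A + B)"
  have xy: "x > 0" "y > 0" using s by (auto simp: x_y_def)
  define P where "P = (of_real x * fst (phases \<sigma> q r), of_real y * snd (phases \<sigma> q r))"
  have nz: "fst (phases \<sigma> q r) \<noteq> 0" "snd (phases \<sigma> q r) \<noteq> 0"
    using phases_norm[of \<sigma> q r] by force+
  \<comment> \<open>Real and imaginary part of the closing condition: the projections onto the first
    side add up to its length 1, and the heights agree.\<close>
  have "x * cos B + y * cos A = 1"
    using s by (simp add: x_y_def sin_add add_divide_distrib[symmetric])
  moreover have "x * sin B = y * sin A" by (simp add: x_y_def)
  ultimately have "1 + fst P + snd P = 0"
    by (simp add: P_def ph complex_eq_iff algebra_simps)
  then have "P \<in> H" using xy nz by (simp add: H_def torus2_def P_def)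
  have "sgn (of_real s * e) = e" if "s > 0" "cmod e = 1" for s e
    using that by (simp add: sgn_eq norm_mult)
  then have "(sgn (fst P), sgn (snd P)) = phases \<sigma> q r"
    using xy phases_norm[of \<sigma> q r] by (simp add: P_def)
  with coamoeba_in_image[OF \<open>P \<in> H\<close>] show ?thesis by simp
qed

text \<open>Starting at 1/2 keeps families with denominator \<open>s\<close> continuous on the
  closed interval.\<close>

lemma limit_in_closure:
  fixes f :: "real \<Rightarrow> 'a::topological_space"
  assumes "continuous_on {1/2..1} f" "\<And>s. 1/2 < s \<Longrightarrow> s < 1 \<Longrightarrow> f s \<in> V"
  shows "f 1 \<in> closure V"
proof -
  have "f ` closure {1/2<..<1} \<subseteq> closure V"
    by (rule image_closure_subset) (use assms closure_subset[of V] in auto)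
  then show ?thesis by auto
qed

text \<open>Points given by strict inequalities are themselves valuations. The unit circles bounding
  the legs are limits along the legs, and the edges of the coamoeba triangles lie on these
  circles.\<close>

lemma tropical_model_subset_closure: "tropical_model \<subseteq> closure (val2_C ` Z_f)"
proof -
  let ?V = "val2_C ` Z_f"
  have 0: "(w, - w) \<in> closure ?V" if "cmod w \<ge> 1" for w
  proof -
    have "(\<lambda>s. (w / of_real s, - w / of_real s)) 1 \<in> closure ?V"
    proof (rule limit_in_closure)
      show "continuous_on {1/2..1} (\<lambda>s. (w / of_real s, - w / of_real s))"
        by (intro continuous_intros) auto
      fix s :: real assume s: "1/2 < s" "s < 1"
      then have "cmod (w / of_real s) > 1" using that by (simp add: norm_divide field_simps)
      then show "(w / of_real s, - w / of_real s) \<in> ?V" using leg0_in_image by fastforce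
    qed
    then show ?thesis by simp
  qed
  have 12: "(w, - 1) \<in> closure ?V" "(- 1, w) \<in> closure ?V" if "w \<noteq> 0" "cmod w \<le> 1" for w
  proof -
    have lt: "of_real s * w \<noteq> 0 \<and> cmod (of_real s * w) < 1" if "1/2 < s" "s < 1" for s :: real
    proof -
      have "s * cmod w \<le> s * 1" using that \<open>cmod w \<le> 1\<close> by (intro mult_left_mono) auto
      then have "s * cmod w < 1" using that by linarith
      then show ?thesis using that \<open>w \<noteq> 0\<close> by (simp add: norm_mult)
    qed
    have "(\<lambda>s. (of_real s * w, - 1)) 1 \<in> closure ?V"
      by (rule limit_in_closure) (use lt leg12_in_image(2) in \<open>auto intro!: continuous_intros\<close>)
    then show "(w, - 1) \<in> closure ?V" by simp
    have "(\<lambda>s. (- 1, of_real s * w)) 1 \<in> closure ?V"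
      by (rule limit_in_closure) (use lt leg12_in_image(1) in \<open>auto intro!: continuous_intros\<close>)
    then show "(- 1, w) \<in> closure ?V" by simp
  qed
  have c: "phases \<sigma> q r \<in> closure ?V" if \<sigma>: "\<sigma> = 1 \<or> \<sigma> = - 1" and qr: "q \<ge> 0" "r \<ge> 0" "q + r \<le> 1" for \<sigma> q r
  proof -
    have nz: "fst (phases \<sigma> q r) \<noteq> 0" "snd (phases \<sigma> q r) \<noteq> 0"
      using phases_norm[of \<sigma> q r] by force+
    consider "q = 0" | "r = 0" | "q + r = 1" | "q > 0" "r > 0" "q + r < 1" using qr by linarith
    then show ?thesis
    proof cases
      case 1
      then have "phases \<sigma> q r = (fst (phases \<sigma> q r), - 1)" by (simp add: phases_def)
      then show ?thesis using 12(1)[OF nz(1)] phases_norm(1)[of \<sigma> q r] by simp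
    next
      case 2
      then have "phases \<sigma> q r = (- 1, snd (phases \<sigma> q r))" by (simp add: phases_def)
      then show ?thesis using 12(2)[OF nz(2)] phases_norm(2)[of \<sigma> q r] by simp
    next
      case 3
      then have "phases \<sigma> q r = (fst (phases \<sigma> q r), - fst (phases \<sigma> q r))"
        using phases_antipodal[OF \<sigma>] by (metis prod.collapse)
      then show ?thesis using 0[of "fst (phases \<sigma> q r)"] phases_norm(1)[of \<sigma> q r] by simp
    next
      case 4
      then show ?thesis using open_coamoeba_in_image[OF \<sigma>] closure_subset by blast
    qed
  qed
  show ?thesis
    unfolding tropical_model_eq leg0_def leg1_def leg2_def closed_coamoeba_def
    using 0 12 c by auto
qed

lemma H_trop_eq: "H_trop = tropical_model"
proof
  show "H_trop \<subseteq> tropical_model"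
    unfolding H_trop_def by (intro closure_of_minimal val2_Z_f_subset tropical_model_closedin)
  have V: "val2_C ` Z_f \<subseteq> torus2" and E: "tropical_model \<subseteq> torus2"
    using val2_Z_f_subset closedin_imp_subset[OF tropical_model_closedin] by auto
  have "H_trop = torus2 \<inter> closure (val2_C ` Z_f)"
    unfolding H_trop_def closure_of_subtopology using V by (simp add: Int_absorb1)
  then show "tropical_model \<subseteq> H_trop"
    using tropical_model_subset_closure E by blast
qed

theorem theorem1p1:
  shows "\<exists>\<Psi> :: (complex \<times> complex) \<times> real \<Rightarrow> complex \<times> complex.
    continuous_on (H \<times> {0..1}) \<Psi> \<and>
    \<Psi> \<in> H \<times> {0..1} \<rightarrow> torus2 \<and>
    (\<forall>P\<in>H. \<Psi> (P, 0) = P) \<and>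
    (\<lambda>P. \<Psi> (P, 1)) ` H = H_trop \<and>
    (\<forall>t\<in>{0..1}. \<exists>g. homeomorphism H ((\<lambda>P. \<Psi> (P, t)) ` H) (\<lambda>P. \<Psi> (P, t)) g)"
proof (intro exI[of _ isotopy] conjI ballI)
  show "isotopy \<in> H \<times> {0..1} \<rightarrow> torus2" by (auto intro: isotopy_in_torus)
  show "(\<lambda>P. isotopy (P, 1)) ` H = H_trop" by (simp add: isotopy_one_image H_trop_eq)
  fix t :: real assume t: "t \<in> {0..1}"
  then have "inj_on (\<lambda>P. isotopy (P, t)) H"
    using isotopy_inj_less_one[of t] isotopy_one_inj by (cases "t = 1") auto
  with t show "\<exists>g. homeomorphism H ((\<lambda>P. isotopy (P, t)) ` H) (\<lambda>P. isotopy (P, t)) g"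
    by (intro isotopy_embedding) auto
qed (simp_all add: continuous_on_isotopy isotopy_zero)

end
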